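(* Let $\varepsilon,\delta>0$, and let the link function $f$ satisfy the standing assumption stated in the context (monotone and bounded, locally linear near $x=1$ with constants $\gamma_0,\gamma_1,\gamma_2$). Let $(a_t,\theta_t)_{t\ge 1}$ be generated by the interactive SGD described in the context, with an initialization $\theta_1\in\mathbb{S}^{d-1}$ such that $\langle\theta_1,\theta^\star\rangle\ge 1-\gamma_0/4$, and let $m_t=\langle\theta^\star,\theta_t\rangle$. 1. (Pure exploration) There is a choice of schedules with $\eta_t=\widetilde{\Theta}\big(\min\{\tfrac{d}{t},\tfrac1d\}\big)$ and $\sigma_t^2=\Theta(1)$ for which, for some $T=\widetilde{O}\big(\tfrac{d^2}{\varepsilon}\big)$, one has $m_T\ge 1-\varepsilon$ with probability at least $1-\delta T$. 2. (Regret minimization) There is a choice of schedules with $\eta_t=\widetilde{\Theta}\big(\min\{\tfrac{1}{\sqrt t},\tfrac1d\}\big)$ and $\sigma_t^2=\widetilde{\Theta}\big(\min\{\tfrac{d}{\sqrt t},1\}\big)$ for which, with probability at least $1-\delta T$, $$\sum_{t=1}^T\big(f(1)-f(m_t)\big)=\widetilde{O}(d\sqrt T).$$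
   Context: Setting. Let $d\ge 2$, $\mathbb{S}^{d-1}$ the unit sphere of $\mathbb{R}^d$, $\theta^\star\in\mathbb{S}^{d-1}$ unknown, and $f:[-1,1]\to\mathbb{R}$ a known differentiable link function. At each round $t\ge1$ the learner plays an action $a_t\in\mathbb{S}^{d-1}$ and observes $r_t=f(\langle\theta^\star,a_t\rangle)+\varepsilon_t$, where the noise $\varepsilon_t$ is, conditionally on the past and on $a_t$, zero-mean and 1-subGaussian. Interactive SGD with schedules $(\eta_t,\sigma_t)_{t\ge1}$, $\eta_t>0$, $\sigma_t\in[0,1]$: given $\theta_t\in\mathbb{S}^{d-1}$, draw (with fresh randomness) $Z_t$ uniformly from $\{a\in\mathbb{S}^{d-1}:\langle a,\theta_t\rangle=0\}$, play $$a_t=\sqrt{1-\sigma_t^2}\,\theta_t+\sigma_tZ_t,$$ and update $$\theta_{t+1/2}=\theta_t-\eta_t\big(f(\langle\theta_t,a_t\rangle)-r_t\big)f'(\langle\theta_t,a_t\rangle)\,(I-\theta_t\theta_t^\top)a_t,\qquad \theta_{t+1}=\frac{\theta_{t+1/2}}{\|\theta_{t+1/2}\|}.$$ Standing assumption on $f$: (i) $f:[-1,1]\to[-1,1]$ is non-decreasing; (ii) $0<\gamma_1\le f'(x)\le\gamma_2$ for all $x\in[1-\gamma_0,1]$, where $\gamma_0,\gamma_1,\gamma_2>0$ are absolute constants with $\gamma_0\le 0.1$. Asymptotic notation: $O,\Theta$ hide constants depending only on $\gamma_0,\gamma_1,\gamma_2$; $\widetilde{O},\widetilde{\Theta}$ additionally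 hide factors polynomial in the logarithms of $d$, $1/\varepsilon$, $1/\delta$ and, for the regret bound and the schedules, of $t$ and $T$. *)

theory Defs
  imports "HOL-Probability.Probability"
begin

text \<open>
  The hidden constants must not depend on the dimension \<open>d\<close>, so \<open>d\<close> has to be quantified inside
  the formula and cannot be a type parameter. The space \<open>R^d\<close> is therefore the set of
  sequences \<open>nat \<Rightarrow> real\<close> that vanish from index \<open>d\<close> on. Random vectors are measurable with respect
  to \<open>borel\<close> on \<open>nat \<Rightarrow> real\<close> (product topology), which induces the usual Borel sets on \<open>R^d\<close>.
\<close>

type_synonym rvec = "nat \<Rightarrow> real"

definition Rn :: "nat \<Rightarrow> rvec set" where
  "Rn d = {x. \<forall>i\<ge>d. x i = 0}"

definition ip :: "nat \<Rightarrow> rvec \<Rightarrow> rvec \<Rightarrow> real" where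
  "ip d x y = (\<Sum>i<d. x i * y i)"

definition vnorm :: "nat \<Rightarrow> rvec \<Rightarrow> real" where
  "vnorm d x = sqrt (ip d x x)"

definition unit_sphere :: "nat \<Rightarrow> rvec set" where
  "unit_sphere d = {x \<in> Rn d. vnorm d x = 1}"

definition orth_sphere :: "nat \<Rightarrow> rvec \<Rightarrow> rvec set" where
  "orth_sphere d v = {a \<in> unit_sphere d. ip d a v = 0}"

definition mat_vec :: "nat \<Rightarrow> (nat \<Rightarrow> nat \<Rightarrow> real) \<Rightarrow> rvec \<Rightarrow> rvec" where
  "mat_vec d A x = (\<lambda>i. if i < d then \<Sum>j<d. A i j * x j else 0)"

definition orth_mat :: "nat \<Rightarrow> (nat \<Rightarrow> nat \<Rightarrow> real) \<Rightarrow> bool" where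
  "orth_mat d A \<longleftrightarrow> (\<forall>i<d. \<forall>j<d. (\<Sum>k<d. A k i * A k j) = (if i = j then 1 else 0))"

text \<open>
  The uniform distribution on the unit sphere of the hyperplane orthogonal to \<open>v\<close> is the
  probability measure carried by that sphere and invariant under all orthogonal maps fixing \<open>v\<close>.
  For \<open>d = 2\<close> the sphere is a pair of antipodal points, which the reflections exchange.
\<close>

definition uniform_orth_sphere :: "nat \<Rightarrow> rvec \<Rightarrow> rvec measure \<Rightarrow> bool" where
  "uniform_orth_sphere d v \<mu> \<longleftrightarrow>
     prob_space \<mu> \<and> sets \<mu> = sets borel \<and> (AE x in \<mu>. x \<in> orth_sphere d v) \<and>
     (\<forall>A. orth_mat d A \<and> mat_vec d A v = v \<longrightarrow> distr \<mu> borel (mat_vec d A) = \<mu>)"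

text \<open>
  \<open>f'\<close> is the derivative of \<open>f\<close> relative to \<open>[-1,1]\<close> (one-sided at the end points), hence it is
  determined by \<open>f\<close> there; the values of both functions outside \<open>[-1,1]\<close> are irrelevant.
\<close>

definition link_function ::
  "real \<Rightarrow> real \<Rightarrow> real \<Rightarrow> (real \<Rightarrow> real) \<Rightarrow> (real \<Rightarrow> real) \<Rightarrow> bool" where
  "link_function \<gamma>0 \<gamma>1 \<gamma>2 f f' \<longleftrightarrow>
     (\<forall>x\<in>{-1..1}. (f has_real_derivative f' x) (at x within {-1..1})) \<and>
     f ` {-1..1} \<subseteq> {-1..1} \<and> mono_on {-1..1} f \<and>
     (\<forall>x\<in>{1 - \<gamma>0..1}. \<gamma>1 \<le> f' x \<and> f' x \<le> \<gamma>2)"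

definition action :: "(nat \<Rightarrow> real) \<Rightarrow> (nat \<Rightarrow> 'w \<Rightarrow> rvec) \<Rightarrow> (nat \<Rightarrow> 'w \<Rightarrow> rvec) \<Rightarrow>
    nat \<Rightarrow> 'w \<Rightarrow> rvec" where
  "action \<sigma> \<theta> Z t \<omega> = (\<lambda>i. sqrt (1 - (\<sigma> t)\<^sup>2) * \<theta> t \<omega> i + \<sigma> t * Z t \<omega> i)"

definition reward :: "nat \<Rightarrow> (real \<Rightarrow> real) \<Rightarrow> rvec \<Rightarrow> (nat \<Rightarrow> 'w \<Rightarrow> rvec) \<Rightarrow> (nat \<Rightarrow> 'w \<Rightarrow> real) \<Rightarrow>
    nat \<Rightarrow> 'w \<Rightarrow> real" where
  "reward d f \<theta>star a \<xi> t \<omega> = f (ip d \<theta>star (a t \<omega>)) + \<xi> t \<omega>"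

definition half_step :: "nat \<Rightarrow> (real \<Rightarrow> real) \<Rightarrow> (real \<Rightarrow> real) \<Rightarrow> real \<Rightarrow> rvec \<Rightarrow> rvec \<Rightarrow> real \<Rightarrow>
    rvec" where
  "half_step d f f' \<eta> v a r =
     (\<lambda>i. v i - \<eta> * (f (ip d v a) - r) * f' (ip d v a) * (a i - ip d v a * v i))"

definition normalize_vec :: "nat \<Rightarrow> rvec \<Rightarrow> rvec" where
  "normalize_vec d x = (\<lambda>i. x i / vnorm d x)"

definition preimages :: "'w measure \<Rightarrow> ('w \<Rightarrow> 'b::topological_space) \<Rightarrow> 'w set set" where
  "preimages M X = {X -` B \<inter> space M | B. B \<in> sets borel}"

definition past_events :: "'w measure \<Rightarrow> (nat \<Rightarrow> 'w \<Rightarrow> rvec) \<Rightarrow> (nat \<Rightarrow> 'w \<Rightarrow> rvec) \<Rightarrow>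
    (nat \<Rightarrow> 'w \<Rightarrow> real) \<Rightarrow> nat \<Rightarrow> 'w set set" where
  "past_events M \<theta> a r t =
     (\<Union>s\<in>{1..t}. preimages M (\<theta> s)) \<union> (\<Union>s\<in>{1..<t}. preimages M (a s) \<union> preimages M (r s))"

definition past :: "'w measure \<Rightarrow> (nat \<Rightarrow> 'w \<Rightarrow> rvec) \<Rightarrow> (nat \<Rightarrow> 'w \<Rightarrow> rvec) \<Rightarrow>
    (nat \<Rightarrow> 'w \<Rightarrow> real) \<Rightarrow> nat \<Rightarrow> 'w measure" where
  "past M \<theta> a r t = sigma (space M) (past_events M \<theta> a r t)"

definition past_action :: "'w measure \<Rightarrow> (nat \<Rightarrow> 'w \<Rightarrow> rvec) \<Rightarrow> (nat \<Rightarrow> 'w \<Rightarrow> rvec) \<Rightarrow>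
    (nat \<Rightarrow> 'w \<Rightarrow> real) \<Rightarrow> nat \<Rightarrow> 'w measure" where
  "past_action M \<theta> a r t = sigma (space M) (past_events M \<theta> a r t \<union> preimages M (a t))"

text \<open>
  In \<open>uniform\<close>, the kernel \<open>K\<close> is a regular conditional distribution of \<open>Z t\<close> given the past.
  In \<open>subgaussian\<close>, the extended nonnegative conditional expectation is used because
  \<open>real_cond_exp\<close> carries no information for functions that are not integrable.
\<close>

locale interactive_sgd = prob_space M
  for M :: "'w measure" +
  fixes d :: nat and f f' :: "real \<Rightarrow> real" and \<eta> \<sigma> :: "nat \<Rightarrow> real" and \<theta>star :: rvec
    and \<theta> Z :: "nat \<Rightarrow> 'w \<Rightarrow> rvec" and \<xi> :: "nat \<Rightarrow> 'w \<Rightarrow> real"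
    and a :: "nat \<Rightarrow> 'w \<Rightarrow> rvec" and r :: "nat \<Rightarrow> 'w \<Rightarrow> real"
  assumes target: "\<theta>star \<in> unit_sphere d"
    and measurable_\<theta>: "\<And>t. t \<ge> 1 \<Longrightarrow> \<theta> t \<in> borel_measurable M"
    and measurable_Z: "\<And>t. t \<ge> 1 \<Longrightarrow> Z t \<in> borel_measurable M"
    and measurable_\<xi>: "\<And>t. t \<ge> 1 \<Longrightarrow> \<xi> t \<in> borel_measurable M"
    and initial: "\<And>\<omega>. \<omega> \<in> space M \<Longrightarrow> \<theta> 1 \<omega> \<in> unit_sphere d"
    and a_eq: "a = action \<sigma> \<theta> Z"
    and r_eq: "r = reward d f \<theta>star a \<xi>"
    and Z_orth: "\<And>t \<omega>. t \<ge> 1 \<Longrightarrow> \<omega> \<in> space M \<Longrightarrow> Z t \<omega> \<in> orth_sphere d (\<theta> t \<omega>)"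
    and uniform: "\<And>t. t \<ge> 1 \<Longrightarrow>
      \<exists>K \<in> past M \<theta> a r t \<rightarrow>\<^sub>M prob_algebra borel.
        (\<forall>\<omega>\<in>space M. uniform_orth_sphere d (\<theta> t \<omega>) (K \<omega>)) \<and>
        (\<forall>B\<in>sets borel. AE \<omega> in M.
           real_cond_exp M (past M \<theta> a r t) (\<lambda>\<omega>'. indicator B (Z t \<omega>')) \<omega> = measure (K \<omega>) B)"
    and mean_zero: "\<And>t. t \<ge> 1 \<Longrightarrow>
      integrable M (\<xi> t) \<and> (AE \<omega> in M. real_cond_exp M (past_action M \<theta> a r t) (\<xi> t) \<omega> = 0)"
    and subgaussian: "\<And>t l. t \<ge> 1 \<Longrightarrow>
      AE \<omega> in M. nn_cond_exp M (past_action M \<theta> a r t) (\<lambda>\<omega>'. ennreal (exp (l * \<xi> t \<omega>'))) \<omega>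
        \<le> ennreal (exp (l\<^sup>2 / 2))"
    and update: "\<And>t \<omega>. t \<ge> 1 \<Longrightarrow> \<omega> \<in> space M \<Longrightarrow>
      \<theta> (Suc t) \<omega> = normalize_vec d (half_step d f f' (\<eta> t) (\<theta> t \<omega>) (a t \<omega>) (r t \<omega>))"

definition schedules :: "(nat \<Rightarrow> real) \<Rightarrow> (nat \<Rightarrow> real) \<Rightarrow> bool" where
  "schedules \<eta> \<sigma> \<longleftrightarrow> (\<forall>t\<ge>1. \<eta> t > 0 \<and> 0 \<le> \<sigma> t \<and> \<sigma> t \<le> 1)"

text \<open>
  Up to a constant, every polynomial in the logarithms of the entries of \<open>xs\<close> is bounded by a
  power of \<open>logs xs\<close>. The shifts by one keep the factor at least 1 for all positive entries.
\<close>

definition logs :: "real list \<Rightarrow> real" where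
  "logs xs = 1 + (\<Sum>x\<leftarrow>xs. ln (1 + x))"

definition within_factor :: "real \<Rightarrow> real \<Rightarrow> real \<Rightarrow> bool" where
  "within_factor K x y \<longleftrightarrow> y / K \<le> x \<and> x \<le> K * y"

end

theory Submission
  imports Defs
begin

text \<open>The residual is nonlinear in \<open>X\<close>: with \<open>m = 1 - h\<close> it is f(c m
  + \<sigma> X) - f(c m) minus an offset f(c) - f(c m) of order \<open>h\<close>. The offset depends
  on the past only, so its product with \<open>X\<close> has mean zero; what remains is a monotone
  increment, whose product with \<open>X\<close> is at least \<gamma>1 \<sigma> X^2. An inverse
  temperature of order 1/\<eta> is admissible because the fluctuations are small where the drift is
  small. The quadratic term of the exponential is again a multiple of X^2, so a small \<lambda>
  \<eta> lets half of the drift absorb it. Only the cost of normalising the iterate, of order p^2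
  for the step length \<open>p\<close>, is not proportional to X^2, and it makes up the bias. Two
  obstacles remain. As \<lambda> grows with time, the old moment bounds the new one only through the
  convexity of exp. And the linear region may be left, with small probability; so expectations are
  restricted to a decreasing sequence of past-measurable events, and Markov's inequality is charged
  once per time step, for a first exit.\<close>

text \<open>
  Let \<open>h = 1 - \<langle>\<theta>*, \<theta>\<^sub>t\<rangle>\<close> and let \<open>X\<close> be the component of \<open>\<theta>*\<close> along the exploration direction. In the
  linear region of \<open>f\<close>, invariance of the uniform distribution under reflections gives \<open>X\<close> mean zero
  and second moment \<open>(1 - (1 - h)\<^sup>2) / (d - 1)\<close>, so one update contracts \<open>h\<close> on average by a factor
  \<open>1 - a\<close> with \<open>a\<close> of order \<open>\<eta> \<sigma>\<^sup>2 / d\<close>, up to a bias \<open>\<beta>\<close> of order \<open>\<eta>\<^sup>2 \<sigma>\<^sup>2\<close>. This persists for the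
  exponential moment: the conditional expectation of \<open>exp (\<lambda> h')\<close> is at most
  \<open>exp (\<lambda> ((1 - a) h + \<beta>))\<close> as long as \<open>\<lambda> \<eta>\<close> is small. If \<open>\<eta>\<close> decreases no faster than by the factor
  \<open>1 - a / 2\<close>, then \<open>\<lambda> = \<kappa> / \<eta>\<close> and the centring \<open>y = const * \<eta> d\<close> make the expectation of
  \<open>exp (\<lambda> (h - y))\<close>, restricted to the event that the iterates have stayed in the linear region, at
  most 1 for all time. Markov's inequality and a union bound give
  \<open>h\<^sub>t = O(d \<eta>\<^sub>t log (1 / \<delta>))\<close> simultaneously for all \<open>t \<le> T\<close>, from which both claims follow.
\<close>

subsection \<open>The coordinate inner product\<close>

lemma ip_commute: "ip d x y = ip d y x"
  by (simp add: ip_def mult.commute)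

lemma ip_lincomb: "ip d x (\<lambda>i. s * y i + t * z i) = s * ip d x y + t * ip d x z"
  by (simp add: ip_def algebra_simps sum.distrib sum_distrib_left)

lemma ip_lincomb_left: "ip d (\<lambda>i. s * y i + t * z i) x = s * ip d y x + t * ip d z x"
  by (simp add: ip_def algebra_simps sum.distrib sum_distrib_left)

lemma ip_scale_left: "ip d (\<lambda>i. s * y i) x = s * ip d y x"
  and ip_scale: "ip d x (\<lambda>i. s * y i) = s * ip d x y"
  by (simp_all add: ip_def algebra_simps sum_distrib_left)

lemma ip_self_nonneg: "ip d x x \<ge> 0"
  by (simp add: ip_def sum_nonneg)

lemma ip_self_lincomb:
  "ip d (\<lambda>i. s * y i + t * z i) (\<lambda>i. s * y i + t * z i)
     = s\<^sup>2 * ip d y y + 2 * s * t * ip d y z + t\<^sup>2 * ip d z z"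
  unfolding ip_lincomb ip_commute[of d "\<lambda>i. s * y i + t * z i"]
  by (simp add: ip_commute[of d z y] algebra_simps power2_eq_square)

lemma Cauchy_Schwarz_ip: "(ip d x y)\<^sup>2 \<le> ip d x x * ip d y y"
  using Cauchy_Schwarz_ineq_sum[of x y "{..<d}"] by (simp add: ip_def power2_eq_square)

lemma unit_sphere_ip: "x \<in> unit_sphere d \<Longrightarrow> ip d x x = 1"
  by (simp add: unit_sphere_def vnorm_def)

lemma unit_sphereI: "x \<in> Rn d \<Longrightarrow> ip d x x = 1 \<Longrightarrow> x \<in> unit_sphere d"
  by (simp add: unit_sphere_def vnorm_def)

lemma unit_sphere_ip_abs_le:
  assumes "x \<in> unit_sphere d" "y \<in> unit_sphere d"
  shows "\<bar>ip d x y\<bar> \<le> 1"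
  using Cauchy_Schwarz_ip[of d x y] unit_sphere_ip[OF assms(1)] unit_sphere_ip[OF assms(2)]
  by (simp add: abs_square_le_1)

text \<open>Cauchy-Schwarz against the projection \<open>y\<close> of \<open>x\<close> onto the span
  of \<open>v\<close> and \<open>z\<close>, for which the inner product of \<open>x\<close> and
  \<open>y\<close> is the squared length of \<open>y\<close>.\<close>

lemma orth_sphere_Bessel:
  assumes x: "x \<in> unit_sphere d" and v: "v \<in> unit_sphere d" and z: "z \<in> orth_sphere d v"
  shows "(ip d x v)\<^sup>2 + (ip d x z)\<^sup>2 \<le> 1"
proof -
  let ?m = "ip d x v" and ?X = "ip d x z"
  let ?y = "\<lambda>i. ?m * v i + ?X * z i"
  have "ip d v z = 0" "ip d z z = 1"
    using z by (auto simp: orth_sphere_def ip_commute unit_sphere_ip)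
  hence "ip d ?y ?y = ?m\<^sup>2 + ?X\<^sup>2" "ip d x ?y = ?m\<^sup>2 + ?X\<^sup>2"
    by (simp_all only: ip_self_lincomb ip_lincomb unit_sphere_ip[OF v]) (simp_all add: power2_eq_square)
  hence "(?m\<^sup>2 + ?X\<^sup>2)\<^sup>2 \<le> ?m\<^sup>2 + ?X\<^sup>2"
    using Cauchy_Schwarz_ip[of d x ?y] unit_sphere_ip[OF x] by simp
  hence "(?m\<^sup>2 + ?X\<^sup>2) * ((?m\<^sup>2 + ?X\<^sup>2) - 1) \<le> 0"
    by (simp add: power2_eq_square algebra_simps)
  thus ?thesis
    by (auto simp: mult_le_0_iff intro: order_trans[OF _ zero_le_one])
qed

lemma borel_measurable_ip [measurable (raw)]:
  assumes [measurable]: "g \<in> borel_measurable N" "h \<in> borel_measurable N"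
  shows "(\<lambda>\<omega>. ip d (g \<omega>) (h \<omega>)) \<in> borel_measurable N"
proof -
  have [measurable]: "(\<lambda>\<omega>. g \<omega> i) \<in> borel_measurable N" "(\<lambda>\<omega>. h \<omega> i) \<in> borel_measurable N" for i
    using assms by (auto intro: measurable_product_then_coordinatewise)
  show ?thesis unfolding ip_def by measurable
qed

subsection \<open>Moments of the uniform distribution on the orthogonal sphere\<close>

text \<open>One family covers both maps used below: the half-turn -I + 2 v v^T about the axis
  \<open>v\<close>, and the Householder reflection I - (2/N) n n^T.\<close>

definition axial_mat :: "real \<Rightarrow> real \<Rightarrow> rvec \<Rightarrow> nat \<Rightarrow> nat \<Rightarrow> real" where
  "axial_mat s t n = (\<lambda>i j. s * (if i = j then 1 else 0) + t * (n i * n j))"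

lemma mat_vec_axial: "mat_vec d (axial_mat s t n) x = (\<lambda>i. if i < d then s * x i + t * ip d n x * n i else 0)"
proof
  fix i
  have "(\<Sum>j<d. axial_mat s t n i j * x j) = s * x i + t * ip d n x * n i" if "i < d"
  proof -
    have "(\<Sum>j<d. axial_mat s t n i j * x j)
        = (\<Sum>j<d. (if i = j then s * x j else 0)) + (\<Sum>j<d. t * (n j * x j) * n i)"
      unfolding axial_mat_def sum.distrib[symmetric] by (intro sum.cong) (auto simp: algebra_simps)
    also have "\<dots> = s * x i + t * ip d n x * n i"
      using that by (simp add: ip_def sum_distrib_left sum_distrib_right)
    finally show ?thesis .
  qed
  thus "mat_vec d (axial_mat s t n) x i = (if i < d then s * x i + t * ip d n x * n i else 0)"
    by (simp add: mat_vec_def)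
qed

text \<open>Here A^T A = s^2 I + (2 s t + t^2 |n|^2) n n^T.\<close>

lemma orth_mat_axial:
  assumes "s\<^sup>2 = 1" "2 * s * t + t\<^sup>2 * ip d n n = 0"
  shows "orth_mat d (axial_mat s t n)"
  unfolding orth_mat_def
proof (intro allI impI)
  fix i j assume ij: "i < d" "j < d"
  have "(\<Sum>k<d. axial_mat s t n k i * axial_mat s t n k j)
      = (\<Sum>k<d. if k = i then (if i = j then s\<^sup>2 else 0) else 0)
        + (\<Sum>k<d. if k = i then s * t * (n i * n j) else 0)
        + (\<Sum>k<d. if k = j then s * t * (n i * n j) else 0)
        + (\<Sum>k<d. t\<^sup>2 * (n i * n j) * (n k * n k))"
    unfolding axial_mat_def sum.distrib[symmetric]
    by (intro sum.cong) (auto simp: algebra_simps power2_eq_square)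
  also have "\<dots> = (if i = j then s\<^sup>2 else 0) + (n i * n j) * (2 * s * t + t\<^sup>2 * ip d n n)"
    using ij by (simp add: ip_def sum_distrib_left algebra_simps)
  also have "\<dots> = (if i = j then 1 else 0)"
    using assms by simp
  finally show "(\<Sum>k<d. axial_mat s t n k i * axial_mat s t n k j) = (if i = j then 1 else 0)" .
qed

lemma ip_mat_vec_axial: "ip d u (mat_vec d (axial_mat s t n) x) = s * ip d u x + t * ip d n x * ip d u n"
proof -
  have "ip d u (mat_vec d (axial_mat s t n) x) = ip d u (\<lambda>i. s * x i + (t * ip d n x) * n i)"
    unfolding mat_vec_axial by (simp add: ip_def)
  thus ?thesis by (simp only: ip_lincomb)
qed

lemma measurable_mat_vec [measurable]: "mat_vec d A \<in> borel_measurable borel"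
proof (rule measurable_coordinatewise_then_product)
  fix i show "(\<lambda>x. mat_vec d A x i) \<in> borel_measurable borel"
    by (cases "i < d") (simp_all add: mat_vec_def)
qed

locale uniform_orth =
  fixes d :: nat and v :: rvec and \<mu> :: "rvec measure"
  assumes uniform: "uniform_orth_sphere d v \<mu>" and unit: "v \<in> unit_sphere d" and dim: "d \<ge> 2"
begin

lemma prob_space_mu: "prob_space \<mu>" and sets_mu [measurable_cong, simp]: "sets \<mu> = sets borel"
  and support: "AE x in \<mu>. x \<in> orth_sphere d v"
  using uniform by (auto simp: uniform_orth_sphere_def)

lemma integral_mat_vec:
  fixes F :: "rvec \<Rightarrow> real"
  assumes "orth_mat d A" "mat_vec d A v = v" "F \<in> borel_measurable borel"
  shows "(\<integral>x. F (mat_vec d A x) \<partial>\<mu>) = (\<integral>x. F x \<partial>\<mu>)"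
proof -
  have "(\<integral>x. F x \<partial>\<mu>) = (\<integral>x. F x \<partial>distr \<mu> borel (mat_vec d A))"
    using uniform assms by (simp add: uniform_orth_sphere_def)
  also have "\<dots> = (\<integral>x. F (mat_vec d A x) \<partial>\<mu>)"
    using assms by (intro integral_distr) auto
  finally show ?thesis by simp
qed

lemma unit_outside: "\<not> i < d \<Longrightarrow> v i = 0"
  using unit by (simp add: unit_sphere_def Rn_def)

text \<open>The half-turn about \<open>v\<close> fixes \<open>v\<close> and maps every
  \<open>x\<close> orthogonal to \<open>v\<close> to \<open>-x\<close>, so by invariance the mean
  equals its own negative. This also covers d = 2, where the sphere has two points.\<close>

lemma first_moment: "(\<integral>x. ip d u x \<partial>\<mu>) = 0"
proof -
  have o: "orth_mat d (axial_mat (-1) 2 v)"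
    by (rule orth_mat_axial) (simp_all add: unit_sphere_ip[OF unit])
  have f: "mat_vec d (axial_mat (-1) 2 v) v = v"
    by (auto simp: mat_vec_axial unit_sphere_ip[OF unit] unit_outside)
  have "(\<integral>x. ip d u x \<partial>\<mu>) = (\<integral>x. ip d u (mat_vec d (axial_mat (-1) 2 v) x) \<partial>\<mu>)"
    by (rule integral_mat_vec[OF o f, symmetric]) simp
  also have "\<dots> = (\<integral>x. - ip d u x \<partial>\<mu>)"
    using support
    by (intro integral_cong_AE)
       (auto elim!: eventually_mono simp: ip_mat_vec_axial orth_sphere_def ip_commute)
  finally show ?thesis by simp
qed

lemma bounded_integrable:
  fixes F :: "rvec \<Rightarrow> real"
  assumes [measurable]: "F \<in> borel_measurable borel" and "\<And>x. x \<in> orth_sphere d v \<Longrightarrow> \<bar>F x\<bar> \<le> B"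
  shows "integrable \<mu> F"
proof -
  interpret prob_space \<mu> by (rule prob_space_mu)
  show ?thesis
    using support assms(2) by (intro integrable_const_bound[where B = B]) (auto elim!: eventually_mono)
qed

lemma ip_bound: "x \<in> orth_sphere d v \<Longrightarrow> (ip d u x)\<^sup>2 \<le> ip d u u"
  using Cauchy_Schwarz_ip[of d u x] by (simp add: orth_sphere_def unit_sphere_ip)

text \<open>The reflection exchanging two vectors of equal length fixes everything orthogonal to both.\<close>

lemma second_moment_eq:
  assumes "ip d u v = 0" "ip d w v = 0" "ip d u u = ip d w w"
  shows "(\<integral>x. (ip d u x)\<^sup>2 \<partial>\<mu>) = (\<integral>x. (ip d w x)\<^sup>2 \<partial>\<mu>)"
proof -
  define n where "n = (\<lambda>i. 1 * u i + (-1) * w i)"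
  define N where "N = ip d n n"
  have N: "N = 2 * (ip d u u - ip d u w)"
    unfolding N_def n_def ip_self_lincomb using assms by simp
  have nx: "ip d n x = ip d u x - ip d w x" for x
    unfolding n_def ip_lincomb_left by simp
  show ?thesis
  proof (cases "N = 0")
    \<comment> \<open>The reflection is undefined when N = 0, but then the first \<open>d\<close>
      coordinates of \<open>u\<close> and \<open>w\<close> agree, and \<open>ip d\<close> sees no
      others.\<close>
    case True
    have "ip d u x = ip d w x" for x
    proof -
      have "(ip d n x)\<^sup>2 \<le> N * ip d x x"
        unfolding N_def by (rule Cauchy_Schwarz_ip)
      hence "ip d n x = 0" using True by simp
      thus ?thesis by (simp add: nx)
    qed
    thus ?thesis by simp
  next
    case False
    let ?A = "axial_mat 1 (-2 / N) n"
    have o: "orth_mat d ?A"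
      using False by (intro orth_mat_axial) (simp_all add: N_def[symmetric] power2_eq_square field_simps)
    have f: "mat_vec d ?A v = v"
      by (auto simp: mat_vec_axial nx assms unit_outside)
    have un: "ip d u n = N / 2"
      by (subst ip_commute) (simp add: nx N ip_commute[of d w u])
    have "ip d u (mat_vec d ?A x) = ip d w x" for x
      unfolding ip_mat_vec_axial un using False by (simp add: nx field_simps)
    thus ?thesis
      using integral_mat_vec[OF o f, of "\<lambda>x. (ip d u x)\<^sup>2"] by simp
  qed
qed

text \<open>Rescale both vectors to the common length sqrt(|u|^2 |w|^2). The cross-multiplied form
  stays valid for zero vectors, which occur among the \<open>e i\<close> of the next lemma.\<close>

lemma second_moment_scale:
  assumes "ip d u v = 0" "ip d w v = 0"
  shows "ip d w w * (\<integral>x. (ip d u x)\<^sup>2 \<partial>\<mu>) = ip d u u * (\<integral>x. (ip d w x)\<^sup>2 \<partial>\<mu>)"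
proof -
  let ?u = "\<lambda>i. sqrt (ip d w w) * u i" and ?w = "\<lambda>i. sqrt (ip d u u) * w i"
  have "(\<integral>x. (ip d ?u x)\<^sup>2 \<partial>\<mu>) = (\<integral>x. (ip d ?w x)\<^sup>2 \<partial>\<mu>)"
    by (rule second_moment_eq) (use assms in \<open>simp_all add: ip_scale ip_scale_left ip_self_nonneg flip: mult.assoc\<close>)
  thus ?thesis
    by (simp add: ip_scale_left power_mult_distrib ip_self_nonneg)
qed

text \<open>The projections \<open>e i\<close> of the standard basis onto the complement of
  \<open>v\<close> form a tight frame: their squared lengths sum to d - 1, and the squares of their
  products with a unit \<open>x\<close> orthogonal to \<open>v\<close> sum to 1. Comparing
  \<open>u\<close> with each \<open>e i\<close> and summing gives the claim without choosing an
  orthonormal basis.\<close>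

lemma second_moment_orth:
  assumes u: "ip d u v = 0"
  shows "(real d - 1) * (\<integral>x. (ip d u x)\<^sup>2 \<partial>\<mu>) = ip d u u"
proof -
  interpret prob_space \<mu> by (rule prob_space_mu)
  define e where "e i = (\<lambda>j. 1 * (if j = i then 1 else 0) + (- v i) * v j)" for i :: nat
  have delta: "ip d x (\<lambda>j. if j = i then 1 else 0) = x i" if "i < d" for x i
    using that by (simp add: ip_def if_distrib[of "\<lambda>y. _ * y"] cong: if_cong)
  have ev: "ip d (e i) x = x i - v i * ip d v x" if "i < d" for i x
    unfolding e_def ip_lincomb_left using that by (subst ip_commute) (simp add: delta)
  have e_orth: "ip d (e i) v = 0" if "i < d" for i
    using that by (simp add: ev unit_sphere_ip[OF unit])
  have e_self: "ip d (e i) (e i) = 1 - (v i)\<^sup>2" if "i < d" for i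
  proof -
    have "ip d (e i) (e i) = e i i - v i * ip d (e i) v"
      using ev[OF that, of "e i"] unfolding ip_commute[of d v "e i"] .
    thus ?thesis
      using that by (simp add: e_orth) (simp add: e_def power2_eq_square)
  qed
  have int: "integrable \<mu> (\<lambda>x. (ip d w x)\<^sup>2)" for w
    by (rule bounded_integrable[where B = "ip d w w"]) (auto simp: ip_bound)
  have "(real d - 1) * (\<integral>x. (ip d u x)\<^sup>2 \<partial>\<mu>) = (\<Sum>i<d. ip d (e i) (e i)) * (\<integral>x. (ip d u x)\<^sup>2 \<partial>\<mu>)"
    using unit_sphere_ip[OF unit]
    by (simp add: e_self sum_subtractf) (simp add: ip_def power2_eq_square)
  also have "\<dots> = (\<Sum>i<d. ip d u u * (\<integral>x. (ip d (e i) x)\<^sup>2 \<partial>\<mu>))"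
    unfolding sum_distrib_right by (intro sum.cong) (auto intro: second_moment_scale e_orth u)
  also have "\<dots> = ip d u u * (\<integral>x. (\<Sum>i<d. (ip d (e i) x)\<^sup>2) \<partial>\<mu>)"
    by (simp add: Bochner_Integration.integral_sum int sum_distrib_left)
  also have "(\<integral>x. (\<Sum>i<d. (ip d (e i) x)\<^sup>2) \<partial>\<mu>) = (\<integral>x. 1 \<partial>\<mu>)"
  proof (rule integral_cong_AE)
    show "AE x in \<mu>. (\<Sum>i<d. (ip d (e i) x)\<^sup>2) = 1"
      using support
    proof eventually_elim
      case (elim x)
      hence "ip d v x = 0" "ip d x x = 1"
        by (auto simp: orth_sphere_def unit_sphere_ip ip_commute[of d v])
      hence "(\<Sum>i<d. (ip d (e i) x)\<^sup>2) = ip d x x"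
        unfolding ip_def[of d x x] by (intro sum.cong) (simp_all add: ev power2_eq_square)
      thus ?case using \<open>ip d x x = 1\<close> by simp
    qed
  qed auto
  finally show ?thesis by (simp only: prob_space lebesgue_integral_const) simp
qed

text \<open>The component of \<open>u\<close> along \<open>v\<close> is invisible on the support, so
  it can be subtracted first.\<close>

lemma second_moment: "(\<integral>x. (ip d u x)\<^sup>2 \<partial>\<mu>) = (ip d u u - (ip d u v)\<^sup>2) / (real d - 1)"
proof -
  define w where "w = (\<lambda>i. 1 * u i + (- ip d u v) * v i)"
  have w: "ip d w x = ip d u x - ip d u v * ip d v x" for x
    unfolding w_def ip_lincomb_left by simp
  have 1: "ip d w v = 0"
    by (simp add: w unit_sphere_ip[OF unit])
  have 2: "ip d w w = ip d u u - (ip d u v)\<^sup>2"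
    unfolding w_def ip_self_lincomb unit_sphere_ip[OF unit] by (simp add: power2_eq_square)
  have "(\<integral>x. (ip d u x)\<^sup>2 \<partial>\<mu>) = (\<integral>x. (ip d w x)\<^sup>2 \<partial>\<mu>)"
  proof (rule integral_cong_AE)
    show "AE x in \<mu>. (ip d u x)\<^sup>2 = (ip d w x)\<^sup>2"
      using support by eventually_elim (simp add: w orth_sphere_def ip_commute[of d v])
  qed auto
  hence "(real d - 1) * (\<integral>x. (ip d u x)\<^sup>2 \<partial>\<mu>) = ip d u u - (ip d u v)\<^sup>2"
    using second_moment_orth[OF 1] unfolding 2 by simp
  thus ?thesis
    using dim by (simp add: eq_divide_eq mult.commute)
qed

end

subsection \<open>The link function\<close>

lemma link_range: "link_function \<gamma>0 \<gamma>1 \<gamma>2 f f' \<Longrightarrow> x \<in> {-1..1} \<Longrightarrow> f x \<in> {-1..1}"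
  unfolding link_function_def by blast

lemma link_mono: "link_function \<gamma>0 \<gamma>1 \<gamma>2 f f' \<Longrightarrow> x \<le> y \<Longrightarrow> x \<in> {-1..1} \<Longrightarrow> y \<in> {-1..1} \<Longrightarrow> f x \<le> f y"
  unfolding link_function_def by (blast intro: mono_onD)

lemma link_deriv_bounds:
  "link_function \<gamma>0 \<gamma>1 \<gamma>2 f f' \<Longrightarrow> x \<in> {1 - \<gamma>0..1} \<Longrightarrow> \<gamma>1 \<le> f' x \<and> f' x \<le> \<gamma>2"
  unfolding link_function_def by blast

text \<open>Outside \<open>{-1..1}\<close> the link function may fail to be measurable, so the range restriction matters.\<close>

lemma link_measurable:
  assumes link: "link_function \<gamma>0 \<gamma>1 \<gamma>2 f f'" and g [measurable]: "g \<in> borel_measurable N"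
    and range: "\<And>\<omega>. \<omega> \<in> space N \<Longrightarrow> g \<omega> \<in> {-1..1}"
  shows "(\<lambda>\<omega>. f (g \<omega>)) \<in> borel_measurable N"
proof -
  have "continuous_on {-1..1} f"
    using link by (auto simp: link_function_def intro!: has_field_derivative_imp_has_derivative
      has_derivative_continuous_on DERIV_continuous_on)
  hence "continuous_on UNIV (\<lambda>x. f (max (-1) (min 1 x)))"
    by (rule continuous_on_compose2) (auto intro!: continuous_intros)
  hence [measurable]: "(\<lambda>x. f (max (-1) (min 1 x))) \<in> borel_measurable borel"
    by (rule borel_measurable_continuous_onI)
  have "(\<lambda>\<omega>. f (max (-1) (min 1 (g \<omega>)))) \<in> borel_measurable N"
    by measurable
  moreover have "max (-1) (min 1 (g \<omega>)) = g \<omega>" if "\<omega> \<in> space N" for \<omega>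
    using range[OF that] by auto
  ultimately show ?thesis
    by (subst measurable_cong[where g = "\<lambda>\<omega>. f (max (-1) (min 1 (g \<omega>)))"]) auto
qed

lemma link_slope:
  assumes link: "link_function \<gamma>0 \<gamma>1 \<gamma>2 f f'" and "\<gamma>0 \<le> 1 / 10" and xy: "1 - \<gamma>0 \<le> x" "x \<le> y" "y \<le> 1"
  shows "\<gamma>1 * (y - x) \<le> f y - f x" and "f y - f x \<le> \<gamma>2 * (y - x)"
proof -
  have "\<gamma>1 * (y - x) \<le> f y - f x \<and> f y - f x \<le> \<gamma>2 * (y - x)"
  proof (cases "x = y")
    case False
    hence "x < y" using xy by simp
    have "(f has_derivative (*) (f' z)) (at z within {x..y})" if "x \<le> z" "z \<le> y" for z
      using link that xy \<open>\<gamma>0 \<le> 1 / 10\<close> unfolding link_function_def has_field_derivative_def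
      by (intro has_derivative_subset[where s = "{-1..1}" and t = "{x..y}"]) auto
    from mvt_simple[OF \<open>x < y\<close>, of f "\<lambda>z. (*) (f' z)", OF this]
    obtain z where z: "z \<in> {x<..<y}" "f y - f x = f' z * (y - x)" by auto
    have "\<gamma>1 \<le> f' z" "f' z \<le> \<gamma>2"
      using link_deriv_bounds[OF link, of z] z xy by auto
    thus ?thesis using \<open>x < y\<close> by (simp add: z(2))
  qed simp
  thus "\<gamma>1 * (y - x) \<le> f y - f x" "f y - f x \<le> \<gamma>2 * (y - x)" by auto
qed

text \<open>The factor \<open>s\<close> makes the lower slope bound independent of the sign of
  \<open>s\<close>; the exploration component takes both signs.\<close>

lemma link_slope_square:
  assumes link: "link_function \<gamma>0 \<gamma>1 \<gamma>2 f f'" and "\<gamma>0 \<le> 1 / 10"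
    and "x \<in> {1 - \<gamma>0..1}" "x + s \<in> {1 - \<gamma>0..1}"
  shows "\<gamma>1 * s\<^sup>2 \<le> (f (x + s) - f x) * s"
proof (cases "s \<ge> 0")
  case True
  have "\<gamma>1 * s * s \<le> (f (x + s) - f x) * s"
    using link_slope(1)[OF assms(1,2), of x "x + s"] assms True by (intro mult_right_mono) auto
  thus ?thesis by (simp add: power2_eq_square algebra_simps)
next
  case False
  have "\<gamma>1 * (- s) * (- s) \<le> (f x - f (x + s)) * (- s)"
    using link_slope(1)[OF assms(1,2), of "x + s" x] assms False by (intro mult_right_mono) auto
  thus ?thesis by (simp add: power2_eq_square algebra_simps)
qed

subsection \<open>A single update\<close>

text \<open>The prediction \<open>f c\<close> and the slope \<open>f' c\<close> are deterministic,
  and projecting the action orthogonally to \<open>v\<close> leaves \<open>s * z\<close>, so the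
  iterate moves along \<open>z\<close> only.\<close>

lemma half_step_eq:
  assumes v: "v \<in> unit_sphere d" and z: "z \<in> orth_sphere d v"
  shows "half_step d f f' \<eta> v (\<lambda>i. c * v i + s * z i) r
     = (\<lambda>i. v i + \<eta> * f' c * s * (r - f c) * z i)"
proof -
  have "ip d v (\<lambda>i. c * v i + s * z i) = c"
    unfolding ip_lincomb using z by (simp add: unit_sphere_ip[OF v] orth_sphere_def ip_commute[of d v z])
  thus ?thesis
    unfolding half_step_def by (simp add: algebra_simps)
qed

text \<open>With N the product of \<open>x\<close> with the unnormalised vector and R its length,
  dividing by R changes N by N (R - 1) / R. By Cauchy-Schwarz N \<le> R, so normalising costs at
  most R - 1, whatever the sign of N.\<close>

lemma
  assumes v: "v \<in> unit_sphere d" and z: "z \<in> orth_sphere d v"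
  shows normalized_step_unit: "normalize_vec d (\<lambda>i. v i + q * z i) \<in> unit_sphere d"
    and normalized_step_gap: "x \<in> unit_sphere d \<Longrightarrow>
      1 - ip d x (normalize_vec d (\<lambda>i. v i + q * z i))
        \<le> 1 - ip d x v - q * ip d x z + (sqrt (1 + q\<^sup>2) - 1)"
proof -
  let ?w = "\<lambda>i. v i + q * z i" and ?R = "sqrt (1 + q\<^sup>2)"
  have zz: "ip d z z = 1" "ip d v z = 0"
    using z by (auto simp: orth_sphere_def unit_sphere_ip ip_commute[of d v z])
  have ww: "ip d ?w ?w = 1 + q\<^sup>2"
    using ip_self_lincomb[of d 1 v q z] by (simp add: unit_sphere_ip[OF v] zz)
  have R: "?R \<ge> 1" "?R\<^sup>2 = 1 + q\<^sup>2" by auto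
  have norm: "normalize_vec d ?w = (\<lambda>i. (1 / ?R) * ?w i)"
    by (simp add: normalize_vec_def vnorm_def ww)
  show "normalize_vec d ?w \<in> unit_sphere d"
  proof (rule unit_sphereI)
    show "normalize_vec d ?w \<in> Rn d"
      using v z by (auto simp: norm unit_sphere_def orth_sphere_def Rn_def)
    have "ip d (normalize_vec d ?w) (normalize_vec d ?w) = (1 / ?R) * ((1 / ?R) * (1 + q\<^sup>2))"
      unfolding norm ip_scale ip_scale_left ww ..
    also have "\<dots> = (1 + q\<^sup>2) / ?R\<^sup>2" by (simp add: power2_eq_square)
    also have "\<dots> = 1" using R by (simp add: add_pos_nonneg less_imp_neq[symmetric] del: real_sqrt_pow2)
    finally show "ip d (normalize_vec d ?w) (normalize_vec d ?w) = 1" .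
  qed
  assume x: "x \<in> unit_sphere d"
  let ?N = "ip d x v + q * ip d x z"
  have N: "ip d x ?w = ?N" using ip_lincomb[of d x 1 v q z] by simp
  have "?N\<^sup>2 \<le> ?R\<^sup>2"
    using Cauchy_Schwarz_ip[of d x ?w] unit_sphere_ip[OF x] unfolding ww N R by simp
  hence "?N \<le> ?R" by (rule power2_le_imp_le) (use R(1) in linarith)
  moreover have "n - n / s \<le> s - 1" if "n \<le> s" "s \<ge> 1" for n s :: real
  proof -
    have "n * (s - 1) \<le> s * (s - 1)" using that by (intro mult_right_mono) auto
    thus ?thesis using that by (simp add: field_simps)
  qed
  ultimately have "?N - ?N / ?R \<le> ?R - 1" using R(1) by blast
  moreover have "ip d x (normalize_vec d ?w) = ?N / ?R"
    unfolding norm ip_scale N by simp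
  ultimately show "1 - ip d x (normalize_vec d ?w) \<le> 1 - ip d x v - q * ip d x z + (?R - 1)"
    by simp
qed

section \<open>Exponential moment of one normalised step\<close>

lemma exp_le_quadratic: "exp v \<le> 1 + v + v\<^sup>2 / 2 * exp \<bar>v\<bar>" for v :: real
proof -
  obtain t where t: "\<bar>t\<bar> \<le> \<bar>v\<bar>" "exp v = (\<Sum>m<2. v ^ m / fact m) + exp t / fact 2 * v ^ 2"
    using Maclaurin_exp_le[of v 2] by blast
  have "exp t * v\<^sup>2 \<le> exp \<bar>v\<bar> * v\<^sup>2"
    using t(1) by (intro mult_right_mono) auto
  thus ?thesis
    unfolding t(2) by (simp add: numeral_2_eq_2 mult.commute)
qed

lemma sqrt_one_plus_square_le:
  "sqrt (1 + q\<^sup>2) - 1 \<le> q\<^sup>2 / 2" "sqrt (1 + q\<^sup>2) - 1 \<le> \<bar>q\<bar>" "0 \<le> sqrt (1 + q\<^sup>2) - 1" for q :: real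
proof -
  have "sqrt (1 + q\<^sup>2) \<le> 1 + q\<^sup>2 / 2"
    by (rule real_le_lsqrt) (simp_all add: power2_sum add_nonneg_nonneg)
  thus "sqrt (1 + q\<^sup>2) - 1 \<le> q\<^sup>2 / 2" by simp
  have "sqrt (1 + q\<^sup>2) \<le> 1 + \<bar>q\<bar>"
    by (rule real_le_lsqrt) (auto simp: power2_eq_square algebra_simps)
  thus "sqrt (1 + q\<^sup>2) - 1 \<le> \<bar>q\<bar>" by simp
qed auto

text \<open>
  Since \<open>sqrt (1 + q\<^sup>2) - 1\<close> is at most \<open>\<bar>q\<bar>\<close>, the exponent grows only linearly in the noise, and the
  remainder is controlled by the exponential moment \<open>exp \<bar>\<xi>\<bar>\<close>; no moment of \<open>exp (s * \<xi>\<^sup>2)\<close> is needed.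
\<close>

lemma exp_step_le:
  fixes l p X \<Delta> \<xi> :: real
  assumes l: "l \<ge> 0" and p: "p \<ge> 0" and lp: "l * p \<le> 1 / 4" and X: "\<bar>X\<bar> \<le> 1" and \<Delta>: "\<bar>\<Delta>\<bar> \<le> 2"
  defines "q \<equiv> p * (\<Delta> + \<xi>)"
  shows "exp (l * (- q * X + (sqrt (1 + q\<^sup>2) - 1)))
    \<le> 1 - l * p * (\<Delta> + \<xi>) * X + 90 * ((l * p)\<^sup>2 * X\<^sup>2 + l * p * p) * exp \<bar>\<xi>\<bar>"
proof -
  define g where "g = \<bar>\<Delta> + \<xi>\<bar>"
  define b where "b = \<bar>\<xi>\<bar>"
  define k where "k = l * p"
  define \<psi> where "\<psi> = sqrt (1 + q\<^sup>2) - 1"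
  define v where "v = l * (- q * X + \<psi>)"
  have b0: "b \<ge> 0" and g0: "g \<ge> 0" and k0: "k \<ge> 0" and k4: "k \<le> 1 / 4"
    using l p lp by (auto simp: b_def g_def k_def)
  have gb: "g \<le> 2 + b" using \<Delta> by (auto simp: g_def b_def)
  have absq: "\<bar>q\<bar> = p * g" and q2: "q\<^sup>2 = p\<^sup>2 * g\<^sup>2"
    using p by (simp_all add: q_def g_def abs_mult power_mult_distrib)
  have \<psi>: "\<psi> \<le> q\<^sup>2 / 2" "\<psi> \<le> \<bar>q\<bar>" "0 \<le> \<psi>"
    unfolding \<psi>_def by (rule sqrt_one_plus_square_le)+
  have l\<psi>1: "l * \<psi> \<le> k * p * g\<^sup>2 / 2"
    using mult_left_mono[OF \<psi>(1) l] unfolding q2 k_def power2_eq_square[of p] by (simp add: mult.assoc)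
  have l\<psi>2: "l * \<psi> \<le> k * g"
    using mult_left_mono[OF \<psi>(2) l] by (simp add: absq k_def)
  have lqX: "\<bar>l * q * X\<bar> = k * g * \<bar>X\<bar>"
    using l by (simp add: abs_mult absq k_def)
  have "k * g * \<bar>X\<bar> \<le> k * g" using X k0 g0 by (simp add: mult_left_le)
  hence "\<bar>v\<bar> \<le> 2 * (k * g)"
    using lqX l\<psi>2 mult_nonneg_nonneg[OF l \<psi>(3)] by (simp add: v_def algebra_simps)
  \<comment> \<open>The bound 1/4 on \<open>l * p\<close> is chosen here: it makes
    \<open>exp \<bar>v\<bar>\<close> cost only exp(b/2), and the other half of exp b pays for the
    powers of \<open>g\<close>.\<close>
  also have "\<dots> \<le> 2 * (1 / 4 * (2 + b))"
    using k0 k4 g0 gb by (intro mult_left_mono mult_mono) auto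
  finally have absv: "\<bar>v\<bar> \<le> 1 + b / 2" by simp
  have "exp \<bar>v\<bar> \<le> exp (1 + b / 2)" using absv by simp
  also have "\<dots> = exp 1 * exp (b / 2)" by (rule exp_add)
  also have "\<dots> \<le> 3 * exp (b / 2)"
    by (intro mult_right_mono exp_le) simp
  finally have expv: "exp \<bar>v\<bar> \<le> 3 * exp (b / 2)" .
  have "1 + b / 4 \<le> exp (b / 4)" by (rule exp_ge_add_one_self)
  hence "g \<le> 4 * exp (b / 4)" using gb b0 by linarith
  hence "g\<^sup>2 \<le> (4 * exp (b / 4))\<^sup>2" using g0 by (rule power_mono)
  moreover have "exp (b / 4) ^ 2 = exp (b / 2)"
    using exp_of_nat_mult[of 2 "b / 4"] by simp
  ultimately have g2: "g\<^sup>2 \<le> 16 * exp (b / 2)" by (simp add: power_mult_distrib)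
  have "1 + b / 6 \<le> exp (b / 6)" by (rule exp_ge_add_one_self)
  hence "g \<le> 6 * exp (b / 6)" using gb b0 by linarith
  hence "g ^ 3 \<le> (6 * exp (b / 6)) ^ 3" using g0 by (rule power_mono)
  moreover have "exp (b / 6) ^ 3 = exp (b / 2)"
    using exp_of_nat_mult[of 3 "b / 6"] by simp
  ultimately have g3: "g ^ 3 \<le> 216 * exp (b / 2)" by (simp add: power_mult_distrib)
  have eb: "exp (b / 2) * exp (b / 2) = exp b" using exp_add[of "b / 2" "b / 2"] by simp
  have eb1: "exp (b / 2) \<le> exp b" using b0 by simp
  have "v\<^sup>2 \<le> 2 * (l * q * X)\<^sup>2 + 2 * (l * \<psi>)\<^sup>2"
    using sum_squares_bound[of "- (l * q * X)" "l * \<psi>"]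
    by (simp add: v_def power2_eq_square algebra_simps)
  also have "(l * q * X)\<^sup>2 = k\<^sup>2 * X\<^sup>2 * g\<^sup>2"
    using arg_cong[OF lqX, of "\<lambda>y. y\<^sup>2"] by (simp add: power_mult_distrib)
  \<comment> \<open>One factor is bounded linearly, the other quadratically. Two linear bounds would
    lose the factor \<open>p\<close>; two quadratic ones would leave k^2 p^2, and only
    \<open>l * p\<close>, not \<open>k * p\<close>, is known to be small.\<close>
  also have "(l * \<psi>)\<^sup>2 \<le> k * g * (k * p * g\<^sup>2 / 2)"
    unfolding power2_eq_square[of "l * \<psi>"] using l \<psi>(3) k0 g0 p l\<psi>1 l\<psi>2 by (intro mult_mono[of "l * \<psi>" _ "l * \<psi>"]) auto
  also have "\<dots> = k * (k * p * g ^ 3 / 2)" by (simp add: power2_eq_square power3_eq_cube)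
  also have "\<dots> \<le> 1 / 4 * (k * p * g ^ 3 / 2)"
    using k0 k4 p g0 by (intro mult_right_mono) auto
  finally have v2: "v\<^sup>2 / 2 \<le> k\<^sup>2 * X\<^sup>2 * g\<^sup>2 + k * p * g ^ 3 / 8" by simp
  have "v\<^sup>2 / 2 * exp \<bar>v\<bar> \<le> (k\<^sup>2 * X\<^sup>2 * (16 * exp (b / 2)) + k * p * (216 * exp (b / 2)) / 8) * (3 * exp (b / 2))"
  proof (intro mult_mono expv order_trans[OF v2] add_mono divide_right_mono mult_left_mono g2 g3)
  qed (use k0 p g0 in auto)
  also have "\<dots> = (48 * (k\<^sup>2 * X\<^sup>2) + 81 * (k * p)) * exp b"
    unfolding eb[symmetric] by (simp add: algebra_simps)
  finally have quad: "v\<^sup>2 / 2 * exp \<bar>v\<bar> \<le> (48 * (k\<^sup>2 * X\<^sup>2) + 81 * (k * p)) * exp b" .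
  have "k * p * g\<^sup>2 / 2 \<le> k * p * (16 * exp b) / 2"
    using k0 p by (intro divide_right_mono mult_left_mono order_trans[OF g2] mult_left_mono eb1) auto
  hence lin: "v \<le> - (l * q * X) + 8 * (k * p) * exp b"
    using l\<psi>1 by (simp add: v_def algebra_simps)
  have "exp v \<le> 1 + (- (l * q * X) + 8 * (k * p) * exp b) + (48 * (k\<^sup>2 * X\<^sup>2) + 81 * (k * p)) * exp b"
    using exp_le_quadratic[of v] lin quad by linarith
  also have "\<dots> = 1 - l * q * X + (48 * (k\<^sup>2 * X\<^sup>2) + 89 * (k * p)) * exp b"
    by (simp add: algebra_simps)
  \<comment> \<open>48 and 89 = 81 + 8 are rounded up to a common constant.\<close>
  also have "\<dots> \<le> 1 - l * q * X + (90 * (k\<^sup>2 * X\<^sup>2) + 90 * (k * p)) * exp b"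
    using k0 p by (intro add_left_mono mult_right_mono add_mono) auto
  finally show ?thesis
    unfolding v_def \<psi>_def k_def b_def by (simp add: q_def algebra_simps)
qed

subsection \<open>The process and its filtration\<close>

locale linked_sgd =
  interactive_sgd M d f f' \<eta> \<sigma> \<theta>star \<theta> Z \<xi> a r
  for M :: "'w measure" and d f f' \<eta> \<sigma> \<theta>star \<theta> Z \<xi> a r +
  fixes \<gamma>0 \<gamma>1 \<gamma>2 :: real
  assumes link: "link_function \<gamma>0 \<gamma>1 \<gamma>2 f f'"
    and \<gamma>0_pos: "0 < \<gamma>0" and \<gamma>0_le: "\<gamma>0 \<le> 1 / 10" and \<gamma>1_pos: "0 < \<gamma>1" and \<gamma>2_pos: "0 < \<gamma>2"
    and dim: "d \<ge> 2"
    and \<eta>_pos: "\<And>t. t \<ge> 1 \<Longrightarrow> 0 < \<eta> t"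
    and \<sigma>_pos: "\<And>t. t \<ge> 1 \<Longrightarrow> 0 < \<sigma> t"
    and \<sigma>_small: "\<And>t. t \<ge> 1 \<Longrightarrow> (\<sigma> t)\<^sup>2 \<le> \<gamma>0 / 100"
begin

definition gap :: "nat \<Rightarrow> 'w \<Rightarrow> real" where
  "gap t \<omega> = 1 - ip d \<theta>star (\<theta> t \<omega>)"

definition dir :: "nat \<Rightarrow> 'w \<Rightarrow> real" where
  "dir t \<omega> = ip d \<theta>star (Z t \<omega>)"

text \<open>The product of the current iterate with its own action; it is the same for every
  outcome, hence so are the prediction and slope used in the update.\<close>

definition c :: "nat \<Rightarrow> real" where
  "c t = sqrt (1 - (\<sigma> t)\<^sup>2)"

text \<open>The residual without noise: expected reward minus prediction. The update moves the
  iterate by \<open>p t * (\<Delta> t \<omega> + \<xi> t \<omega>)\<close> along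
  \<open>Z t \<omega>\<close>.\<close>

definition \<Delta> :: "nat \<Rightarrow> 'w \<Rightarrow> real" where
  "\<Delta> t \<omega> = f (c t * (1 - gap t \<omega>) + \<sigma> t * dir t \<omega>) - f (c t)"

definition p :: "nat \<Rightarrow> real" where
  "p t = \<eta> t * f' (c t) * \<sigma> t"

lemma \<sigma>_sq_le_1: "t \<ge> 1 \<Longrightarrow> (\<sigma> t)\<^sup>2 \<le> 1"
  using \<sigma>_small[of t] \<gamma>0_le by simp

lemma c_bounds:
  assumes "t \<ge> 1"
  shows "1 - \<gamma>0 / 100 \<le> c t" "c t \<le> 1" "(c t)\<^sup>2 = 1 - (\<sigma> t)\<^sup>2"
proof -
  have *: "0 \<le> 1 - (\<sigma> t)\<^sup>2" "1 - (\<sigma> t)\<^sup>2 \<le> 1" using \<sigma>_sq_le_1[OF assms] by auto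
  have "1 - (\<sigma> t)\<^sup>2 \<le> c t"
    unfolding c_def using * by (intro real_le_rsqrt) (simp add: power2_eq_square mult_left_le)
  thus "1 - \<gamma>0 / 100 \<le> c t" using \<sigma>_small[OF assms] by simp
  show "c t \<le> 1" "(c t)\<^sup>2 = 1 - (\<sigma> t)\<^sup>2" using * by (auto simp: c_def)
qed

lemma c_deriv: "t \<ge> 1 \<Longrightarrow> \<gamma>1 \<le> f' (c t) \<and> f' (c t) \<le> \<gamma>2"
  using c_bounds[of t] \<gamma>0_pos by (intro link_deriv_bounds[OF link]) auto

lemma p_pos: "t \<ge> 1 \<Longrightarrow> 0 < p t"
  using c_deriv[of t] \<eta>_pos[of t] \<sigma>_pos[of t] \<gamma>1_pos by (simp add: p_def)

lemma a_app: "a t \<omega> = (\<lambda>i. c t * \<theta> t \<omega> i + \<sigma> t * Z t \<omega> i)"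
  by (simp add: a_eq action_def c_def)

lemma ip_action: "ip d \<theta>star (a t \<omega>) = c t * (1 - gap t \<omega>) + \<sigma> t * dir t \<omega>"
  by (simp only: a_app ip_lincomb gap_def dir_def) simp

lemma step:
  assumes "t \<ge> 1" "\<omega> \<in> space M" "\<theta> t \<omega> \<in> unit_sphere d"
  shows "\<theta> (Suc t) \<omega> = normalize_vec d (\<lambda>i. \<theta> t \<omega> i + (p t * (\<Delta> t \<omega> + \<xi> t \<omega>)) * Z t \<omega> i)"
  unfolding update[OF assms(1,2)] a_app half_step_eq[OF assms(3) Z_orth[OF assms(1,2)]]
  by (simp add: r_eq reward_def ip_action p_def \<Delta>_def algebra_simps)

lemma \<theta>_unit:
  assumes "t \<ge> 1" "\<omega> \<in> space M"
  shows "\<theta> t \<omega> \<in> unit_sphere d"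
  using assms(1)
proof (induction t rule: dec_induct)
  case base
  show ?case using initial[OF assms(2)] by simp
next
  case (step t)
  hence "t \<ge> 1" by simp
  show ?case
    unfolding linked_sgd.step[OF linked_sgd_axioms \<open>t \<ge> 1\<close> assms(2) step.IH]
    by (rule normalized_step_unit[OF step.IH Z_orth[OF \<open>t \<ge> 1\<close> assms(2)]])
qed

lemma gap_bounds:
  assumes "t \<ge> 1" "\<omega> \<in> space M"
  shows "0 \<le> gap t \<omega>" "gap t \<omega> \<le> 2"
  using unit_sphere_ip_abs_le[OF target \<theta>_unit[OF assms]] by (auto simp: gap_def)

lemma Bessel:
  assumes "t \<ge> 1" "\<omega> \<in> space M"
  shows "(1 - gap t \<omega>)\<^sup>2 + (dir t \<omega>)\<^sup>2 \<le> 1"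
  using orth_sphere_Bessel[OF target \<theta>_unit[OF assms] Z_orth[OF assms]] by (simp add: gap_def dir_def)

lemma dir_le_1:
  assumes "t \<ge> 1" "\<omega> \<in> space M"
  shows "\<bar>dir t \<omega>\<bar> \<le> 1"
proof -
  have "(dir t \<omega>)\<^sup>2 \<le> 1"
    using Bessel[OF assms] zero_le_power2[of "1 - gap t \<omega>"] by linarith
  thus ?thesis by (simp add: abs_square_le_1)
qed

lemma a_unit:
  assumes "t \<ge> 1" "\<omega> \<in> space M"
  shows "a t \<omega> \<in> unit_sphere d"
proof (rule unit_sphereI)
  have Z: "Z t \<omega> \<in> unit_sphere d" "ip d (\<theta> t \<omega>) (Z t \<omega>) = 0"
    using Z_orth[OF assms] by (auto simp: orth_sphere_def ip_commute[of d "\<theta> t \<omega>" "Z t \<omega>"])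
  show "a t \<omega> \<in> Rn d"
    using \<theta>_unit[OF assms] Z(1) by (auto simp: a_app unit_sphere_def Rn_def)
  show "ip d (a t \<omega>) (a t \<omega>) = 1"
    unfolding a_app ip_self_lincomb unit_sphere_ip[OF \<theta>_unit[OF assms]] unit_sphere_ip[OF Z(1)] Z(2)
    by (simp add: c_bounds(3)[OF assms(1)])
qed

text \<open>Boundedness, monotonicity and measurability of \<open>f\<close> are available on [-1,1]
  only, so this range is needed for every outcome and not just in the linear region.\<close>

lemma ip_action_range:
  assumes "t \<ge> 1" "\<omega> \<in> space M"
  shows "c t * (1 - gap t \<omega>) + \<sigma> t * dir t \<omega> \<in> {-1..1}"
  using unit_sphere_ip_abs_le[OF target a_unit[OF assms]] by (auto simp: ip_action abs_le_iff)

lemma cm_range: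
  assumes "t \<ge> 1" "\<omega> \<in> space M"
  shows "c t * (1 - gap t \<omega>) \<in> {-1..1}"
proof -
  have "\<bar>c t * (1 - gap t \<omega>)\<bar> \<le> 1 * 1"
    unfolding abs_mult using c_bounds[OF assms(1)] \<gamma>0_le gap_bounds[OF assms]
    by (intro mult_mono) auto
  thus ?thesis by (auto simp: abs_le_iff)
qed

lemma c_range: "t \<ge> 1 \<Longrightarrow> c t \<in> {-1..1}"
  using c_bounds[of t] \<gamma>0_le by auto

lemma \<Delta>_bound:
  assumes "t \<ge> 1" "\<omega> \<in> space M"
  shows "\<bar>\<Delta> t \<omega>\<bar> \<le> 2"
  using link_range[OF link ip_action_range[OF assms]] link_range[OF link c_range[OF assms(1)]]
  by (auto simp: \<Delta>_def)

lemma gap_step: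
  assumes "t \<ge> 1" "\<omega> \<in> space M"
  defines "q \<equiv> p t * (\<Delta> t \<omega> + \<xi> t \<omega>)"
  shows "gap (Suc t) \<omega> \<le> gap t \<omega> + (- q * dir t \<omega> + (sqrt (1 + q\<^sup>2) - 1))"
  using normalized_step_gap[OF \<theta>_unit[OF assms(1,2)] Z_orth[OF assms(1,2)] target, of q]
  by (simp add: gap_def dir_def step[OF assms(1,2) \<theta>_unit[OF assms(1,2)]] q_def)

text \<open>On the event \<open>gap t \<omega> \<le> \<gamma>0 / 2\<close> all arguments of \<open>f\<close> lie in its linear region.\<close>

lemma drift_pointwise:
  assumes t: "t \<ge> 1" and \<omega>: "\<omega> \<in> space M" and gap: "gap t \<omega> \<le> \<gamma>0 / 2"
  shows "\<gamma>1 * \<sigma> t * (dir t \<omega>)\<^sup>2 \<le> (\<Delta> t \<omega> + (f (c t) - f (c t * (1 - gap t \<omega>)))) * dir t \<omega>"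
proof -
  let ?x = "c t * (1 - gap t \<omega>)" and ?s = "\<sigma> t * dir t \<omega>"
  have "(1 - \<gamma>0 / 100) * (1 - \<gamma>0 / 2) \<le> ?x"
    using c_bounds[OF t] gap \<gamma>0_pos \<gamma>0_le by (intro mult_mono) auto
  moreover have "1 - \<gamma>0 * (51 / 100) \<le> (1 - \<gamma>0 / 100) * (1 - \<gamma>0 / 2)"
    using \<gamma>0_pos by (simp add: algebra_simps)
  ultimately have x: "1 - \<gamma>0 * (51 / 100) \<le> ?x" by linarith
  \<comment> \<open>By Bessel dir^2 \<le> 2 gap \<le> \<gamma>0. With \<sigma>^2 \<le> \<gamma>0 /
    100 exploration moves the argument by at most \<gamma>0 / 10, and \<open>?x\<close> is at least
    1 - 0.51 \<gamma>0, so both arguments stay above 1 - \<gamma>0.\<close>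
  have "(1 - gap t \<omega>)\<^sup>2 = 1 - 2 * gap t \<omega> + (gap t \<omega>)\<^sup>2"
    by (simp add: power2_eq_square algebra_simps)
  hence "(dir t \<omega>)\<^sup>2 \<le> 2 * gap t \<omega>"
    using Bessel[OF t \<omega>] zero_le_power2[of "gap t \<omega>"] by linarith
  hence "(\<sigma> t)\<^sup>2 * (dir t \<omega>)\<^sup>2 \<le> \<gamma>0 / 100 * \<gamma>0"
    using \<sigma>_small[OF t] gap \<gamma>0_pos by (intro mult_mono) auto
  hence "?s\<^sup>2 \<le> (\<gamma>0 / 10)\<^sup>2" by (simp add: power_mult_distrib power2_eq_square[of "\<gamma>0"] power2_eq_square[of "_ / _"])
  hence s: "\<bar>?s\<bar> \<le> \<gamma>0 / 10"
    using \<gamma>0_pos by (simp flip: abs_le_square_iff)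
  \<comment> \<open>The added offset changes the reference point of \<open>\<Delta>\<close> from
    \<open>c t\<close> to \<open>?x\<close>, the argument without exploration. It depends on the
    past only, so it will average out against \<open>dir\<close>.\<close>
  have "\<gamma>1 * ?s\<^sup>2 \<le> (f (?x + ?s) - f ?x) * ?s"
    using x s cm_range[OF t \<omega>] ip_action_range[OF t \<omega>] \<gamma>0_pos
    by (intro link_slope_square[OF link \<gamma>0_le]) (auto simp: abs_le_iff)
  hence "\<sigma> t * (\<gamma>1 * \<sigma> t * (dir t \<omega>)\<^sup>2) \<le> \<sigma> t * ((\<Delta> t \<omega> + (f (c t) - f ?x)) * dir t \<omega>)"
    by (simp add: \<Delta>_def power2_eq_square algebra_simps)
  thus ?thesis using \<sigma>_pos[OF t] by simp
qed

section \<open>Measurability of the process, and with respect to past and action\<close>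

lemma measurable_gap [measurable]: "t \<ge> 1 \<Longrightarrow> gap t \<in> borel_measurable M"
  and measurable_dir: "t \<ge> 1 \<Longrightarrow> dir t \<in> borel_measurable M"
  using measurable_\<theta>[of t] measurable_Z[of t] unfolding gap_def dir_def by auto

lemma measurable_a: "t \<ge> 1 \<Longrightarrow> a t \<in> borel_measurable M"
proof (rule measurable_coordinatewise_then_product)
  fix i assume t: "t \<ge> 1"
  have [measurable]: "(\<lambda>\<omega>. \<theta> t \<omega> i) \<in> borel_measurable M" "(\<lambda>\<omega>. Z t \<omega> i) \<in> borel_measurable M"
    using measurable_\<theta>[OF t] measurable_Z[OF t] by (auto intro: measurable_product_then_coordinatewise)
  show "(\<lambda>\<omega>. a t \<omega> i) \<in> borel_measurable M"
    unfolding a_app by measurable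
qed

lemma measurable_r:
  assumes "t \<ge> 1"
  shows "r t \<in> borel_measurable M"
proof -
  note [measurable] = measurable_\<xi>[OF assms] measurable_gap[OF assms] measurable_dir[OF assms]
  have [measurable]: "(\<lambda>\<omega>. f (c t * (1 - gap t \<omega>) + \<sigma> t * dir t \<omega>)) \<in> borel_measurable M"
    by (rule link_measurable[OF link _ ip_action_range[OF assms]]) auto
  show ?thesis
    unfolding r_eq reward_def ip_action by measurable
qed

abbreviation "\<F> \<equiv> past M \<theta> a r"
abbreviation "\<G> \<equiv> past_action M \<theta> a r"

lemma preimages_sets: "X \<in> borel_measurable M \<Longrightarrow> preimages M X \<subseteq> sets M"
  by (auto simp: preimages_def measurable_sets)

lemma past_events_sets: "past_events M \<theta> a r t \<subseteq> sets M"
  unfolding past_events_def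
  using preimages_sets[OF measurable_\<theta>] preimages_sets[OF measurable_a] preimages_sets[OF measurable_r]
  by auto blast+

lemma space_past [simp]: "space (\<F> t) = space M" "space (\<G> t) = space M"
  by (simp_all add: past_def past_action_def space_measure_of_conv)

lemma sets_past:
  "sets (\<F> t) = sigma_sets (space M) (past_events M \<theta> a r t)"
  "t \<ge> 1 \<Longrightarrow> sets (\<G> t) = sigma_sets (space M) (past_events M \<theta> a r t \<union> preimages M (a t))"
  unfolding past_def past_action_def
  using past_events_sets[of t] preimages_sets[OF measurable_a, of t] sets.space_closed[of M]
  by (auto intro!: sets_measure_of)

lemma subalgebra_past: "t \<ge> 1 \<Longrightarrow> subalgebra M (\<F> t)" "t \<ge> 1 \<Longrightarrow> subalgebra M (\<G> t)"
  unfolding subalgebra_def sets_past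
  using past_events_sets[of t] preimages_sets[OF measurable_a, of t]
  by (auto intro!: sets.sigma_sets_subset)

lemma past_le_past_action: "t \<ge> 1 \<Longrightarrow> subalgebra (\<G> t) (\<F> t)"
  unfolding subalgebra_def sets_past by (auto intro!: sigma_sets_mono')

lemma measurable_preimages:
  assumes "preimages M X \<subseteq> sets N" "space N = space M"
  shows "X \<in> borel_measurable N"
  using assms by (intro measurableI) (auto simp: preimages_def)

lemma \<theta>_past: "1 \<le> s \<Longrightarrow> s \<le> t \<Longrightarrow> \<theta> s \<in> borel_measurable (\<F> t)"
  by (rule measurable_preimages) (auto simp: sets_past past_events_def intro!: sigma_sets.Basic)

lemma gap_past: "1 \<le> s \<Longrightarrow> s \<le> t \<Longrightarrow> gap s \<in> borel_measurable (\<F> t)"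
  unfolding gap_def using \<theta>_past[of s t] by measurable

lemma a_past_action: "t \<ge> 1 \<Longrightarrow> a t \<in> borel_measurable (\<G> t)"
  by (rule measurable_preimages) (auto simp: sets_past)

lemma gap_past_action: "t \<ge> 1 \<Longrightarrow> gap t \<in> borel_measurable (\<G> t)"
  by (rule measurable_from_subalg[OF past_le_past_action gap_past]) auto

text \<open>The noise is conditioned on the past and the action, not on \<open>Z\<close>. Since
  \<open>\<sigma> t > 0\<close>, \<open>dir\<close> can be solved for from the action and the gap;
  this admits weights containing \<open>dir\<close> in the noise estimates.\<close>

lemma dir_past_action:
  assumes "t \<ge> 1"
  shows "dir t \<in> borel_measurable (\<G> t)"
proof -
  note [measurable] = a_past_action[OF assms] gap_past_action[OF assms]
  have "dir t = (\<lambda>\<omega>. (ip d \<theta>star (a t \<omega>) - c t * (1 - gap t \<omega>)) / \<sigma> t)"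
    using \<sigma>_pos[OF assms] by (auto simp: ip_action)
  thus ?thesis by simp
qed

subsection \<open>Conditional moments of the noise and of the exploration direction\<close>

lemma integrable_bounded:
  fixes W :: "'w \<Rightarrow> real"
  assumes "W \<in> borel_measurable M" "\<And>\<omega>. \<omega> \<in> space M \<Longrightarrow> \<bar>W \<omega>\<bar> \<le> B"
  shows "integrable M W"
  using assms by (intro integrable_const_bound[where B = B]) auto

lemma noise_mean:
  assumes t: "t \<ge> 1" and W: "W \<in> borel_measurable (\<G> t)" and B: "\<And>\<omega>. \<omega> \<in> space M \<Longrightarrow> \<bar>W \<omega>\<bar> \<le> B"
  shows "integrable M (\<lambda>\<omega>. W \<omega> * \<xi> t \<omega>)" "(\<integral>\<omega>. W \<omega> * \<xi> t \<omega> \<partial>M) = 0"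
proof -
  interpret G: finite_measure_subalgebra M "\<G> t"
    by unfold_locales (rule subalgebra_past(2)[OF t])
  have [measurable]: "W \<in> borel_measurable M" "\<xi> t \<in> borel_measurable M"
    using W measurable_from_subalg[OF subalgebra_past(2)[OF t]] measurable_\<xi>[OF t] by auto
  have mz: "integrable M (\<xi> t)" "AE \<omega> in M. real_cond_exp M (\<G> t) (\<xi> t) \<omega> = 0"
    using mean_zero[OF t] by auto
  show int: "integrable M (\<lambda>\<omega>. W \<omega> * \<xi> t \<omega>)"
  proof (rule Bochner_Integration.integrable_bound[where f = "\<lambda>\<omega>. B * \<xi> t \<omega>"])
    show "AE \<omega> in M. norm (W \<omega> * \<xi> t \<omega>) \<le> norm (B * \<xi> t \<omega>)"
      using B by (auto simp: abs_mult intro!: mult_right_mono order_trans[OF B])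
  qed (use mz in auto)
  have "(\<integral>\<omega>. W \<omega> * \<xi> t \<omega> \<partial>M) = (\<integral>\<omega>. W \<omega> * real_cond_exp M (\<G> t) (\<xi> t) \<omega> \<partial>M)"
    by (rule G.real_cond_exp_intg(2)[OF int W, symmetric]) simp
  also have "\<dots> = (\<integral>\<omega>. 0 \<partial>M)"
    using mz(2) by (intro integral_cong_AE) auto
  finally show "(\<integral>\<omega>. W \<omega> * \<xi> t \<omega> \<partial>M) = 0" by simp
qed

text \<open>Stated for nonnegative integrals because integrability of the exponential is a
  conclusion, drawn in \<open>noise_exp\<close>. Only l = 1 and l = -1 occur, which suffices for
  \<open>exp \<bar>\<xi>\<bar>\<close>.\<close>

lemma noise_exp_nn:
  assumes t: "t \<ge> 1" and W: "W \<in> borel_measurable (\<G> t)" and l: "l\<^sup>2 = 1"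
  shows "(\<integral>\<^sup>+\<omega>. ennreal (W \<omega>) * ennreal (exp (l * \<xi> t \<omega>)) \<partial>M) \<le> 2 * (\<integral>\<^sup>+\<omega>. ennreal (W \<omega>) \<partial>M)"
proof -
  interpret G: finite_measure_subalgebra M "\<G> t"
    by unfold_locales (rule subalgebra_past(2)[OF t])
  have [measurable]: "W \<in> borel_measurable M" "\<xi> t \<in> borel_measurable M"
    using W measurable_from_subalg[OF subalgebra_past(2)[OF t]] measurable_\<xi>[OF t] by auto
  have "exp (1 / 2 :: real) ^ 2 \<le> 2 ^ 2"
    using exp_le by (simp flip: exp_of_nat_mult)
  hence "exp (1 / 2 :: real) \<le> 2" by (rule power2_le_imp_le) simp
  hence "ennreal (exp (l\<^sup>2 / 2)) \<le> 2"
    unfolding l by (simp add: ennreal_le_iff[of 2, simplified])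
  hence sg: "AE \<omega> in M. nn_cond_exp M (\<G> t) (\<lambda>\<omega>'. ennreal (exp (l * \<xi> t \<omega>'))) \<omega> \<le> 2"
    using subgaussian[OF t, of l] by (auto elim!: eventually_mono intro: order_trans)
  have "(\<integral>\<^sup>+\<omega>. ennreal (W \<omega>) * ennreal (exp (l * \<xi> t \<omega>)) \<partial>M)
      = (\<integral>\<^sup>+\<omega>. ennreal (W \<omega>) * nn_cond_exp M (\<G> t) (\<lambda>\<omega>'. ennreal (exp (l * \<xi> t \<omega>'))) \<omega> \<partial>M)"
    using W by (intro G.nn_cond_exp_intg[symmetric]) auto
  also have "\<dots> \<le> (\<integral>\<^sup>+\<omega>. 2 * ennreal (W \<omega>) \<partial>M)"
    using sg by (intro nn_integral_mono_AE) (auto elim!: eventually_mono simp: mult.commute[of 2] intro: mult_left_mono)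
  also have "\<dots> = 2 * (\<integral>\<^sup>+\<omega>. ennreal (W \<omega>) \<partial>M)"
    by (rule nn_integral_cmult) simp
  finally show ?thesis .
qed

lemma noise_exp:
  assumes t: "t \<ge> 1" and W: "W \<in> borel_measurable (\<G> t)"
    and B: "\<And>\<omega>. \<omega> \<in> space M \<Longrightarrow> 0 \<le> W \<omega> \<and> W \<omega> \<le> B"
  shows "integrable M (\<lambda>\<omega>. W \<omega> * exp \<bar>\<xi> t \<omega>\<bar>)"
    "(\<integral>\<omega>. W \<omega> * exp \<bar>\<xi> t \<omega>\<bar> \<partial>M) \<le> 4 * (\<integral>\<omega>. W \<omega> \<partial>M)"
proof -
  have [measurable]: "W \<in> borel_measurable M" "\<xi> t \<in> borel_measurable M"
    using W measurable_from_subalg[OF subalgebra_past(2)[OF t]] measurable_\<xi>[OF t] by auto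
  have W_int: "integrable M W"
    using B by (intro integrable_bounded[where B = B]) auto
  have "(\<integral>\<^sup>+\<omega>. ennreal (W \<omega> * exp \<bar>\<xi> t \<omega>\<bar>) \<partial>M)
      \<le> (\<integral>\<^sup>+\<omega>. ennreal (W \<omega>) * ennreal (exp (1 * \<xi> t \<omega>)) + ennreal (W \<omega>) * ennreal (exp (- 1 * \<xi> t \<omega>)) \<partial>M)"
  proof (rule nn_integral_mono)
    fix \<omega> assume \<omega>: "\<omega> \<in> space M"
    have "W \<omega> * exp \<bar>\<xi> t \<omega>\<bar> \<le> W \<omega> * (exp (1 * \<xi> t \<omega>) + exp (- 1 * \<xi> t \<omega>))"
      using B[OF \<omega>] by (intro mult_left_mono) (auto simp: abs_if)
    thus "ennreal (W \<omega> * exp \<bar>\<xi> t \<omega>\<bar>)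
        \<le> ennreal (W \<omega>) * ennreal (exp (1 * \<xi> t \<omega>)) + ennreal (W \<omega>) * ennreal (exp (- 1 * \<xi> t \<omega>))"
      using B[OF \<omega>] by (simp add: distrib_left flip: ennreal_mult ennreal_plus)
  qed
  also have "\<dots> = (\<integral>\<^sup>+\<omega>. ennreal (W \<omega>) * ennreal (exp (1 * \<xi> t \<omega>)) \<partial>M)
      + (\<integral>\<^sup>+\<omega>. ennreal (W \<omega>) * ennreal (exp (- 1 * \<xi> t \<omega>)) \<partial>M)"
    by (rule nn_integral_add) auto
  also have "\<dots> \<le> 2 * (\<integral>\<^sup>+\<omega>. ennreal (W \<omega>) \<partial>M) + 2 * (\<integral>\<^sup>+\<omega>. ennreal (W \<omega>) \<partial>M)"
    by (intro add_mono noise_exp_nn[OF t W]) auto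
  also have "(\<integral>\<^sup>+\<omega>. ennreal (W \<omega>) \<partial>M) = ennreal (\<integral>\<omega>. W \<omega> \<partial>M)"
    using B by (intro nn_integral_eq_integral W_int) auto
  also have "2 * ennreal (\<integral>\<omega>. W \<omega> \<partial>M) + 2 * ennreal (\<integral>\<omega>. W \<omega> \<partial>M) = ennreal (4 * (\<integral>\<omega>. W \<omega> \<partial>M))"
    using B by (simp add: integral_nonneg_AE ennreal_mult' flip: distrib_right)
  finally have *: "(\<integral>\<^sup>+\<omega>. ennreal (W \<omega> * exp \<bar>\<xi> t \<omega>\<bar>) \<partial>M) \<le> ennreal (4 * (\<integral>\<omega>. W \<omega> \<partial>M))" .
  show int: "integrable M (\<lambda>\<omega>. W \<omega> * exp \<bar>\<xi> t \<omega>\<bar>)"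
    using * B by (intro integrableI_nonneg) (auto intro: le_less_trans)
  have "ennreal (\<integral>\<omega>. W \<omega> * exp \<bar>\<xi> t \<omega>\<bar> \<partial>M) \<le> ennreal (4 * (\<integral>\<omega>. W \<omega> \<partial>M))"
    using * B by (subst (asm) nn_integral_eq_integral[OF int]) auto
  moreover have "0 \<le> 4 * (\<integral>\<omega>. W \<omega> \<partial>M)"
    using B by (simp add: integral_nonneg_AE)
  ultimately show "(\<integral>\<omega>. W \<omega> * exp \<bar>\<xi> t \<omega>\<bar> \<partial>M) \<le> 4 * (\<integral>\<omega>. W \<omega> \<partial>M)"
    by (simp add: ennreal_le_iff)
qed

text \<open>Turns a moment that is the same for every invariant measure on the orthogonal sphere
  into a conditional moment of \<open>Z t\<close>. The condition on \<open>\<psi>\<close> ranges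
  over all such measures, as the moments above were derived from invariance alone.\<close>

lemma direction_disintegration:
  assumes t: "t \<ge> 1" and Y: "Y \<in> borel_measurable (\<F> t)"
    and B: "\<And>\<omega>. \<omega> \<in> space M \<Longrightarrow> 0 \<le> Y \<omega> \<and> Y \<omega> \<le> B"
    and \<phi> [measurable]: "\<phi> \<in> borel_measurable borel"
    and \<psi>: "\<And>\<omega> \<mu>. \<omega> \<in> space M \<Longrightarrow> uniform_orth d (\<theta> t \<omega>) \<mu> \<Longrightarrow> (\<integral>\<^sup>+z. \<phi> z \<partial>\<mu>) = \<psi> \<omega>"
  shows "(\<integral>\<^sup>+\<omega>. ennreal (Y \<omega>) * \<phi> (Z t \<omega>) \<partial>M) = (\<integral>\<^sup>+\<omega>. ennreal (Y \<omega>) * \<psi> \<omega> \<partial>M)"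
proof -
  interpret F: finite_measure_subalgebra M "\<F> t"
    by unfold_locales (rule subalgebra_past(1)[OF t])
  obtain K where K: "K \<in> \<F> t \<rightarrow>\<^sub>M prob_algebra borel"
    and unif: "\<And>\<omega>. \<omega> \<in> space M \<Longrightarrow> uniform_orth_sphere d (\<theta> t \<omega>) (K \<omega>)"
    and cond: "\<And>B. B \<in> sets borel \<Longrightarrow>
      AE \<omega> in M. real_cond_exp M (\<F> t) (\<lambda>\<omega>'. indicator B (Z t \<omega>')) \<omega> = measure (K \<omega>) B"
    using uniform[OF t] by blast
  have Y_M [measurable]: "Y \<in> borel_measurable M"
    using Y measurable_from_subalg[OF subalgebra_past(1)[OF t]] by auto
  have Z_M [measurable]: "Z t \<in> borel_measurable M" by (rule measurable_Z[OF t])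
  have K_M: "K \<in> M \<rightarrow>\<^sub>M prob_algebra borel"
    by (rule measurable_from_subalg[OF subalgebra_past(1)[OF t] K])
  let ?D = "density M (\<lambda>\<omega>. ennreal (Y \<omega>))"
  have K_D [measurable]: "K \<in> ?D \<rightarrow>\<^sub>M subprob_algebra borel"
    using measurable_prob_algebraD[OF K_M] by (simp cong: measurable_cong_sets)
  have K_sub [measurable]: "K \<in> M \<rightarrow>\<^sub>M subprob_algebra borel"
    using measurable_prob_algebraD[OF K_M] .
  have prob_K: "prob_space (K \<omega>)" "sets (K \<omega>) = sets borel" if "\<omega> \<in> space M" for \<omega>
    using unif[OF that] by (auto simp: uniform_orth_sphere_def)
  have ne: "space ?D \<noteq> {}" using not_empty by simp
  have B0: "0 \<le> B" using B not_empty by fastforce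
  \<comment> \<open>The conditional law is given set by set, with a null set depending on
    \<open>B\<close>. Integrating against \<open>Y\<close> first yields an identity of two measures,
    from which these null sets have disappeared.\<close>
  have "distr ?D borel (Z t) = ?D \<bind> K"
  proof (rule measure_eqI)
    show "sets (distr ?D borel (Z t)) = sets (?D \<bind> K)"
      using sets_bind_measurable[OF K_D ne] by simp
    fix A assume "A \<in> sets (distr ?D borel (Z t))"
    hence A [measurable]: "A \<in> sets borel" by simp
    have meas_K [measurable]: "(\<lambda>\<omega>. measure (K \<omega>) A) \<in> borel_measurable M"
      by (rule measurable_compose[OF K_sub measurable_measure_subprob_algebra[OF A]])
    have "emeasure (distr ?D borel (Z t)) A = (\<integral>\<^sup>+\<omega>. ennreal (Y \<omega> * indicator A (Z t \<omega>)) \<partial>M)"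
      by (subst emeasure_distr)
         (auto simp: emeasure_density intro!: nn_integral_cong split: split_indicator)
    also have "\<dots> = ennreal (\<integral>\<omega>. Y \<omega> * indicator A (Z t \<omega>) \<partial>M)"
      using B B0 by (intro nn_integral_eq_integral integrable_bounded[where B = B])
         (auto split: split_indicator)
    also have "(\<integral>\<omega>. Y \<omega> * indicator A (Z t \<omega>) \<partial>M)
        = (\<integral>\<omega>. Y \<omega> * real_cond_exp M (\<F> t) (\<lambda>\<omega>'. indicator A (Z t \<omega>')) \<omega> \<partial>M)"
      using B B0 Y by (intro F.real_cond_exp_intg(2)[symmetric] integrable_bounded[where B = B])
         (auto split: split_indicator)
    also have "\<dots> = (\<integral>\<omega>. Y \<omega> * measure (K \<omega>) A \<partial>M)"
      using cond[OF A] by (intro integral_cong_AE) auto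
    also have "ennreal \<dots> = (\<integral>\<^sup>+\<omega>. ennreal (Y \<omega> * measure (K \<omega>) A) \<partial>M)"
    proof (intro nn_integral_eq_integral[symmetric] integrable_bounded[where B = B])
      fix \<omega> assume \<omega>: "\<omega> \<in> space M"
      have "Y \<omega> * measure (K \<omega>) A \<le> B * 1"
        using B[OF \<omega>] prob_space.prob_le_1[OF prob_K(1)[OF \<omega>]] by (intro mult_mono) auto
      thus "\<bar>Y \<omega> * measure (K \<omega>) A\<bar> \<le> B" using B[OF \<omega>] by simp
    qed (use B in auto)
    also have "\<dots> = (\<integral>\<^sup>+\<omega>. ennreal (Y \<omega>) * emeasure (K \<omega>) A \<partial>M)"
      using B prob_K(1)
      by (intro nn_integral_cong)
         (simp add: ennreal_mult' finite_measure.emeasure_eq_measure[OF prob_space.finite_measure])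
    also have "\<dots> = (\<integral>\<^sup>+\<omega>. emeasure (K \<omega>) A \<partial>?D)"
      by (subst nn_integral_density) auto
    also have "\<dots> = emeasure (?D \<bind> K) A"
      by (rule emeasure_bind[OF ne K_D A, symmetric])
    finally show "emeasure (distr ?D borel (Z t)) A = emeasure (?D \<bind> K) A" .
  qed
  hence "(\<integral>\<^sup>+z. \<phi> z \<partial>distr ?D borel (Z t)) = (\<integral>\<^sup>+z. \<phi> z \<partial>(?D \<bind> K))" by simp
  also have "\<dots> = (\<integral>\<^sup>+\<omega>. (\<integral>\<^sup>+z. \<phi> z \<partial>K \<omega>) \<partial>?D)"
    by (rule nn_integral_bind[OF \<phi> K_D])
  also have "\<dots> = (\<integral>\<^sup>+\<omega>. ennreal (Y \<omega>) * (\<integral>\<^sup>+z. \<phi> z \<partial>K \<omega>) \<partial>M)"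
    by (rule nn_integral_density)
       (auto intro!: measurable_compose[OF K_sub nn_integral_measurable_subprob_algebra])
  also have "\<dots> = (\<integral>\<^sup>+\<omega>. ennreal (Y \<omega>) * \<psi> \<omega> \<partial>M)"
    using unif \<theta>_unit[OF t] dim by (intro nn_integral_cong) (simp add: \<psi> uniform_orth_def)
  also have "(\<integral>\<^sup>+z. \<phi> z \<partial>distr ?D borel (Z t)) = (\<integral>\<^sup>+\<omega>. ennreal (Y \<omega>) * \<phi> (Z t \<omega>) \<partial>M)"
    by (simp add: nn_integral_distr nn_integral_density)
  finally show ?thesis .
qed

lemma direction_mean:
  assumes t: "t \<ge> 1" and Y: "Y \<in> borel_measurable (\<F> t)"
    and B: "\<And>\<omega>. \<omega> \<in> space M \<Longrightarrow> 0 \<le> Y \<omega> \<and> Y \<omega> \<le> B"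
  shows "(\<integral>\<omega>. Y \<omega> * dir t \<omega> \<partial>M) = 0"
proof -
  have [measurable]: "Y \<in> borel_measurable M" "dir t \<in> borel_measurable M"
    using Y measurable_from_subalg[OF subalgebra_past(1)[OF t]] measurable_dir[OF t] by auto
  have abs_le: "\<bar>ip d \<theta>star z\<bar> \<le> 1" if "z \<in> orth_sphere d v" for z v
    using that unit_sphere_ip_abs_le[OF target] by (auto simp: orth_sphere_def)
  \<comment> \<open>The disintegration needs a nonnegative integrand; the shift by 1 provides it,
    since the product of two unit vectors is at least -1.\<close>
  have "(\<integral>\<^sup>+\<omega>. ennreal (Y \<omega>) * ennreal (1 + ip d \<theta>star (Z t \<omega>)) \<partial>M) = (\<integral>\<^sup>+\<omega>. ennreal (Y \<omega>) * 1 \<partial>M)"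
  proof (rule direction_disintegration[OF t Y B])
    fix \<omega> \<mu> assume "uniform_orth d (\<theta> t \<omega>) \<mu>"
    then interpret U: uniform_orth d "\<theta> t \<omega>" \<mu> .
    interpret P: prob_space \<mu> by (rule U.prob_space_mu)
    have int: "integrable \<mu> (\<lambda>z. ip d \<theta>star z)"
      by (rule U.bounded_integrable[where B = 1]) (auto simp: abs_le)
    have "(\<integral>\<^sup>+z. ennreal (1 + ip d \<theta>star z) \<partial>\<mu>) = ennreal (\<integral>z. 1 + ip d \<theta>star z \<partial>\<mu>)"
      using U.support int
      by (intro nn_integral_eq_integral) (auto elim!: eventually_mono dest!: abs_le simp: abs_le_iff)
    thus "(\<integral>\<^sup>+z. ennreal (1 + ip d \<theta>star z) \<partial>\<mu>) = 1"
      using int by (simp add: U.first_moment P.prob_space)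
  qed auto
  moreover have "ennreal (Y \<omega>) * ennreal (1 + ip d \<theta>star (Z t \<omega>)) = ennreal (Y \<omega> * (1 + dir t \<omega>))"
    if "\<omega> \<in> space M" for \<omega>
    using B[OF that] dir_le_1[OF t that] by (simp add: dir_def ennreal_mult' abs_le_iff)
  ultimately have "(\<integral>\<^sup>+\<omega>. ennreal (Y \<omega> * (1 + dir t \<omega>)) \<partial>M) = (\<integral>\<^sup>+\<omega>. ennreal (Y \<omega>) \<partial>M)"
    by (simp cong: nn_integral_cong)
  moreover have "0 \<le> Y \<omega> * (1 + dir t \<omega>)" if "\<omega> \<in> space M" for \<omega>
    using B[OF that] dir_le_1[OF t that] by (auto simp: abs_le_iff)
  ultimately have "(\<integral>\<omega>. Y \<omega> * (1 + dir t \<omega>) \<partial>M) = (\<integral>\<omega>. Y \<omega> \<partial>M)"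
    using B by (subst (1 2) integral_eq_nn_integral) auto
  moreover have int: "integrable M Y" "integrable M (\<lambda>\<omega>. Y \<omega> * dir t \<omega>)"
  proof -
    show "integrable M Y" using B by (intro integrable_bounded[where B = B]) auto
    have "\<bar>Y \<omega> * dir t \<omega>\<bar> \<le> B * 1" if "\<omega> \<in> space M" for \<omega>
      unfolding abs_mult using B[OF that] dir_le_1[OF t that] by (intro mult_mono) auto
    thus "integrable M (\<lambda>\<omega>. Y \<omega> * dir t \<omega>)" by (intro integrable_bounded[where B = B]) auto
  qed
  ultimately show ?thesis by (simp add: distrib_left)
qed

lemma direction_second_moment:
  assumes t: "t \<ge> 1" and Y: "Y \<in> borel_measurable (\<F> t)"
    and B: "\<And>\<omega>. \<omega> \<in> space M \<Longrightarrow> 0 \<le> Y \<omega> \<and> Y \<omega> \<le> B"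
  shows "(\<integral>\<omega>. Y \<omega> * (dir t \<omega>)\<^sup>2 \<partial>M) = (\<integral>\<omega>. Y \<omega> * ((1 - (1 - gap t \<omega>)\<^sup>2) / (real d - 1)) \<partial>M)"
proof -
  have [measurable]: "Y \<in> borel_measurable M" "dir t \<in> borel_measurable M" "gap t \<in> borel_measurable M"
    using Y measurable_from_subalg[OF subalgebra_past(1)[OF t]] measurable_dir[OF t] measurable_gap[OF t]
    by auto
  define V where "V \<omega> = (1 - (1 - gap t \<omega>)\<^sup>2) / (real d - 1)" for \<omega>
  have V0: "0 \<le> V \<omega>" if "\<omega> \<in> space M" for \<omega>
    using Bessel[OF t that] zero_le_power2[of "dir t \<omega>"] dim
    unfolding V_def by (intro divide_nonneg_nonneg) (linarith, simp)
  have "(\<integral>\<^sup>+\<omega>. ennreal (Y \<omega>) * ennreal ((ip d \<theta>star (Z t \<omega>))\<^sup>2) \<partial>M) = (\<integral>\<^sup>+\<omega>. ennreal (Y \<omega>) * ennreal (V \<omega>) \<partial>M)"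
  proof (rule direction_disintegration[OF t Y B])
    fix \<omega> \<mu> assume "uniform_orth d (\<theta> t \<omega>) \<mu>"
    then interpret U: uniform_orth d "\<theta> t \<omega>" \<mu> .
    have "integrable \<mu> (\<lambda>z. (ip d \<theta>star z)\<^sup>2)"
      by (rule U.bounded_integrable[where B = "ip d \<theta>star \<theta>star"]) (auto simp: U.ip_bound)
    hence "(\<integral>\<^sup>+z. ennreal ((ip d \<theta>star z)\<^sup>2) \<partial>\<mu>) = ennreal (\<integral>z. (ip d \<theta>star z)\<^sup>2 \<partial>\<mu>)"
      by (intro nn_integral_eq_integral) auto
    thus "(\<integral>\<^sup>+z. ennreal ((ip d \<theta>star z)\<^sup>2) \<partial>\<mu>) = ennreal (V \<omega>)"
      by (simp add: U.second_moment unit_sphere_ip[OF target] V_def gap_def)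
  qed auto
  moreover have "ennreal (Y \<omega>) * ennreal ((ip d \<theta>star (Z t \<omega>))\<^sup>2) = ennreal (Y \<omega> * (dir t \<omega>)\<^sup>2)"
    and "ennreal (Y \<omega>) * ennreal (V \<omega>) = ennreal (Y \<omega> * V \<omega>)"
    if "\<omega> \<in> space M" for \<omega>
    using B[OF that] V0[OF that] by (simp_all add: dir_def ennreal_mult')
  ultimately have "(\<integral>\<^sup>+\<omega>. ennreal (Y \<omega> * (dir t \<omega>)\<^sup>2) \<partial>M) = (\<integral>\<^sup>+\<omega>. ennreal (Y \<omega> * V \<omega>) \<partial>M)"
    by (simp cong: nn_integral_cong)
  moreover have [measurable]: "V \<in> borel_measurable M" unfolding V_def by measurable
  ultimately have "(\<integral>\<omega>. Y \<omega> * (dir t \<omega>)\<^sup>2 \<partial>M) = (\<integral>\<omega>. Y \<omega> * V \<omega> \<partial>M)"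
    using B V0 by (subst (1 2) integral_eq_nn_integral) auto
  thus ?thesis by (simp add: V_def)
qed

end

subsection \<open>The exponential moment recursion\<close>

text \<open>The chord of exp between 0 and \<open>z\<close>. It bounds a moment at a reduced inverse
  temperature by the moment at the current one.\<close>

lemma exp_convex_le: "exp (u * z) \<le> 1 - u + u * exp z" if "0 \<le> u" "u \<le> 1" for u z :: real
  using convex_onD[OF exp_convex, of u 0 z] that by simp

context linked_sgd
begin

text \<open>Per unit of \<open>l\<close>, the drift is at least \<eta> \<gamma>1^2 \<sigma>^2 times
  the second moment of \<open>dir\<close>, which is at least gap / d; the 2 reserves half of the
  drift for the quadratic terms.\<close>

definition rate :: "nat \<Rightarrow> real" where
  "rate t = \<eta> t * (\<sigma> t)\<^sup>2 * \<gamma>1\<^sup>2 / (2 * real d)"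

text \<open>360 = 90 * 4, from \<open>exp_step_le\<close> and \<open>noise_exp\<close>; the rest
  bounds \<open>(p t)^2\<close>.\<close>

definition bias :: "nat \<Rightarrow> real" where
  "bias t = 360 * \<gamma>2\<^sup>2 * (\<eta> t)\<^sup>2 * (\<sigma> t)\<^sup>2"

text \<open>Taking expectations in \<open>exp_step_le\<close> leaves a drift of order
  \<open>k * \<sigma> t\<close> and a quadratic error of order k^2, both multiplying the same second
  moment \<open>V\<close>. Condition \<open>l2\<close> makes the error at most half of the drift;
  \<open>l1\<close> ensures the smallness required by \<open>exp_step_le\<close>.\<close>

lemma exp_gap_one_step:
  assumes t: "t \<ge> 1" and G: "G \<in> sets (\<F> t)" and gapG: "\<And>\<omega>. \<omega> \<in> G \<Longrightarrow> gap t \<omega> \<le> \<gamma>0 / 2"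
    and l: "l > 0" and l1: "4 * (l * \<eta> t * \<gamma>2) \<le> 1" and l2: "720 * (l * \<eta> t * \<gamma>2) \<le> \<gamma>1"
  shows "(\<integral>\<omega>. indicator G \<omega> * exp (l * gap (Suc t) \<omega>) \<partial>M)
    \<le> (\<integral>\<omega>. indicator G \<omega> * exp (l * ((1 - rate t) * gap t \<omega> + bias t)) \<partial>M)"
proof -
  note subM = measurable_from_subalg[OF subalgebra_past(1)[OF t]]
  note subG = measurable_from_subalg[OF past_le_past_action[OF t]]
  have GM: "G \<in> sets M" using G subalgebra_past(1)[OF t] by (auto simp: subalgebra_def)
  hence G_space: "\<omega> \<in> space M" if "\<omega> \<in> G" for \<omega> using that sets.sets_into_space by blast
  define k where "k = l * p t"
  define V where "V \<omega> = (1 - (1 - gap t \<omega>)\<^sup>2) / (real d - 1)" for \<omega>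
  define Y where "Y \<omega> = indicator G \<omega> * exp (l * gap t \<omega>)" for \<omega>
  \<comment> \<open>The past-measurable offset of \<open>drift_pointwise\<close>, weighted by
    \<open>Y\<close>. It is nonnegative because \<open>f\<close> is monotone, so
    \<open>direction_mean\<close> applies to it.\<close>
  define D where "D \<omega> = Y \<omega> * (f (c t) - f (c t * (1 - gap t \<omega>)))" for \<omega>
  define W where "W \<omega> = Y \<omega> * (k\<^sup>2 * (dir t \<omega>)\<^sup>2 + k * p t)" for \<omega>
  define E where "E = exp (2 * l)"
  have E0: "0 \<le> E" by (simp add: E_def)
  have p0: "0 < p t" by (rule p_pos[OF t])
  have k0: "0 < k" using l p0 by (simp add: k_def)
  have \<sigma>01: "0 < \<sigma> t" "\<sigma> t \<le> 1"
    using \<sigma>_pos[OF t] \<sigma>_sq_le_1[OF t] by (auto simp: power_le_one_iff)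
  have f'c: "\<gamma>1 \<le> f' (c t)" "f' (c t) \<le> \<gamma>2" using c_deriv[OF t] by auto
  have p_le: "p t \<le> \<eta> t * \<gamma>2 * \<sigma> t"
    unfolding p_def using f'c \<eta>_pos[OF t] \<sigma>01 by (intro mult_right_mono mult_left_mono) auto
  have p_ge: "\<eta> t * \<gamma>1 * \<sigma> t \<le> p t"
    unfolding p_def using f'c \<eta>_pos[OF t] \<sigma>01 by (intro mult_right_mono mult_left_mono) auto
  have k_le: "k \<le> l * \<eta> t * \<gamma>2 * \<sigma> t"
    unfolding k_def using mult_left_mono[OF p_le, of l] l by (simp add: mult.assoc)
  have "l * \<eta> t * \<gamma>2 * \<sigma> t \<le> 1 / 4 * 1"
    using l l1 \<eta>_pos[OF t] \<gamma>2_pos \<sigma>01 by (intro mult_mono) auto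
  hence k4: "k \<le> 1 / 4" using k_le by simp
  have "720 * (l * \<eta> t * \<gamma>2) * \<sigma> t \<le> \<gamma>1 * \<sigma> t"
    using l2 \<sigma>01 by (intro mult_right_mono) auto
  hence k720: "360 * k \<le> \<gamma>1 * \<sigma> t / 2" using k_le by simp
  have V01: "0 \<le> V \<omega>" "V \<omega> \<le> 1" if "\<omega> \<in> space M" for \<omega>
  proof -
    have "0 \<le> 1 - (1 - gap t \<omega>)\<^sup>2" "1 - (1 - gap t \<omega>)\<^sup>2 \<le> real d - 1"
      using Bessel[OF t that] zero_le_power2[of "dir t \<omega>"] zero_le_power2[of "1 - gap t \<omega>"] dim
      by linarith+
    thus "0 \<le> V \<omega>" "V \<omega> \<le> 1" using dim by (auto simp: V_def)
  qed
  have Y_past: "Y \<in> borel_measurable (\<F> t)"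
    unfolding Y_def using G gap_past[of t t] t by measurable
  have Y_le: "0 \<le> Y \<omega> \<and> Y \<omega> \<le> E" if "\<omega> \<in> space M" for \<omega>
  proof -
    have "l * gap t \<omega> \<le> l * 2" using gap_bounds(2)[OF t that] l by (intro mult_left_mono) auto
    thus ?thesis by (auto simp: Y_def E_def mult.commute split: split_indicator)
  qed
  have D_past: "D \<in> borel_measurable (\<F> t)"
  proof -
    note [measurable] = gap_past[OF t order_refl] Y_past
    have [measurable]: "(\<lambda>\<omega>. f (c t * (1 - gap t \<omega>))) \<in> borel_measurable (\<F> t)"
      by (rule link_measurable[OF link]) (use cm_range[OF t] in auto)
    show ?thesis unfolding D_def by measurable
  qed
  have D_le: "0 \<le> D \<omega> \<and> D \<omega> \<le> E * 2" if "\<omega> \<in> space M" for \<omega>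
  proof -
    have "c t * (1 - gap t \<omega>) \<le> c t"
      using c_bounds[OF t] gap_bounds(1)[OF t that] \<gamma>0_le by (intro mult_left_le) auto
    hence "f (c t * (1 - gap t \<omega>)) \<le> f (c t)"
      by (rule link_mono[OF link]) (use cm_range[OF t that] c_range[OF t] in auto)
    moreover have "f (c t) - f (c t * (1 - gap t \<omega>)) \<le> 2"
      using link_range[OF link cm_range[OF t that]] link_range[OF link c_range[OF t]] by auto
    ultimately show ?thesis
      unfolding D_def using Y_le[OF that] E0 by (auto intro!: mult_mono)
  qed
  have Y_act: "Y \<in> borel_measurable (\<G> t)" by (rule subG[OF Y_past])
  have W_act: "W \<in> borel_measurable (\<G> t)" and Ydir_act: "(\<lambda>\<omega>. Y \<omega> * dir t \<omega>) \<in> borel_measurable (\<G> t)"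
    using Y_act dir_past_action[OF t] unfolding W_def by measurable
  have dir2: "(dir t \<omega>)\<^sup>2 \<le> 1" if "\<omega> \<in> space M" for \<omega>
    using dir_le_1[OF t that] by (simp add: abs_square_le_1)
  have W_le: "0 \<le> W \<omega> \<and> W \<omega> \<le> E * (k\<^sup>2 * 1 + k * p t)" if "\<omega> \<in> space M" for \<omega>
    unfolding W_def using Y_le[OF that] dir2[OF that] k0 p0 E0
    by (auto intro!: mult_mono add_mono mult_left_mono)
  have [measurable]: "Y \<in> borel_measurable M" "D \<in> borel_measurable M" "dir t \<in> borel_measurable M"
    "gap t \<in> borel_measurable M" "gap (Suc t) \<in> borel_measurable M" "V \<in> borel_measurable M" "G \<in> sets M"
    "W \<in> borel_measurable M"
    using subM[OF Y_past] subM[OF D_past] measurable_dir[OF t] measurable_gap[OF t] measurable_gap[of "Suc t"]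
      GM measurable_from_subalg[OF subalgebra_past(2)[OF t] W_act]
    unfolding V_def by auto
  have int_Y: "integrable M Y"
    using Y_le by (intro integrable_bounded[where B = E]) auto
  have int_YV: "integrable M (\<lambda>\<omega>. Y \<omega> * V \<omega>)"
  proof (rule integrable_bounded)
    fix \<omega> assume "\<omega> \<in> space M"
    thus "\<bar>Y \<omega> * V \<omega>\<bar> \<le> E * 1"
      unfolding abs_mult using Y_le V01 E0 by (intro mult_mono) auto
  qed auto
  have int_Ydir2: "integrable M (\<lambda>\<omega>. Y \<omega> * (dir t \<omega>)\<^sup>2)"
  proof (rule integrable_bounded)
    fix \<omega> assume "\<omega> \<in> space M"
    thus "\<bar>Y \<omega> * (dir t \<omega>)\<^sup>2\<bar> \<le> E * 1"
      unfolding abs_mult using Y_le dir2 E0 by (intro mult_mono) auto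
  qed auto
  have int_Ddir: "integrable M (\<lambda>\<omega>. D \<omega> * dir t \<omega>)"
  proof (rule integrable_bounded)
    fix \<omega> assume "\<omega> \<in> space M"
    thus "\<bar>D \<omega> * dir t \<omega>\<bar> \<le> E * 2 * 1"
      unfolding abs_mult using D_le dir_le_1[OF t] E0 by (intro mult_mono) auto
  qed auto
  have Ydir_le: "\<bar>Y \<omega> * dir t \<omega>\<bar> \<le> E * 1" if "\<omega> \<in> space M" for \<omega>
    unfolding abs_mult using Y_le[OF that] dir_le_1[OF t that] E0 by (intro mult_mono) auto
  note noise1 = noise_mean[OF t Ydir_act Ydir_le]
  note noise2 = noise_exp[OF t W_act W_le]
  \<comment> \<open>A pointwise majorant whose terms all have a computable or bounded expectation:
    those with \<open>D\<close> and with the bare noise have mean zero, \<open>dir^2\<close>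
    averages to \<open>V\<close>, and the last is covered by \<open>noise_exp\<close>.\<close>
  define R where "R \<omega> = Y \<omega> + k * (D \<omega> * dir t \<omega>) - k * \<gamma>1 * \<sigma> t * (Y \<omega> * (dir t \<omega>)\<^sup>2)
    - k * (Y \<omega> * dir t \<omega> * \<xi> t \<omega>) + 90 * (W \<omega> * exp \<bar>\<xi> t \<omega>\<bar>)" for \<omega>
  have "(\<integral>\<omega>. indicator G \<omega> * exp (l * gap (Suc t) \<omega>) \<partial>M) \<le> (\<integral>\<omega>. R \<omega> \<partial>M)"
  proof (rule integral_mono)
    show "integrable M (\<lambda>\<omega>. indicator G \<omega> * exp (l * gap (Suc t) \<omega>))"
    proof (rule integrable_bounded[where B = E])
      fix \<omega> assume \<omega>: "\<omega> \<in> space M"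
      have "l * gap (Suc t) \<omega> \<le> l * 2" using gap_bounds(2)[OF _ \<omega>, of "Suc t"] l by (intro mult_left_mono) auto
      thus "\<bar>indicator G \<omega> * exp (l * gap (Suc t) \<omega>)\<bar> \<le> E"
        by (auto simp: E_def mult.commute split: split_indicator)
    qed measurable
    show "integrable M R"
      unfolding R_def using int_Y int_Ddir int_Ydir2 noise1(1) noise2(1) by simp
    fix \<omega> assume \<omega>: "\<omega> \<in> space M"
    show "indicator G \<omega> * exp (l * gap (Suc t) \<omega>) \<le> R \<omega>"
    proof (cases "\<omega> \<in> G")
      case False
      thus ?thesis by (simp add: R_def Y_def D_def W_def)
    next
      case True
      define q where "q = p t * (\<Delta> t \<omega> + \<xi> t \<omega>)"
      have Yw: "Y \<omega> = exp (l * gap t \<omega>)" using True by (simp add: Y_def)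
      have "exp (l * gap (Suc t) \<omega>) \<le> exp (l * (gap t \<omega> + (- q * dir t \<omega> + (sqrt (1 + q\<^sup>2) - 1))))"
        using gap_step[OF t \<omega>] l by (auto simp: q_def intro!: mult_left_mono)
      also have "\<dots> = Y \<omega> * exp (l * (- q * dir t \<omega> + (sqrt (1 + q\<^sup>2) - 1)))"
        by (simp only: Yw distrib_left[of l "gap t \<omega>"] exp_add)
      also have "\<dots> \<le> Y \<omega> * (1 - k * (\<Delta> t \<omega> + \<xi> t \<omega>) * dir t \<omega>
          + 90 * (k\<^sup>2 * (dir t \<omega>)\<^sup>2 + k * p t) * exp \<bar>\<xi> t \<omega>\<bar>)"
        unfolding k_def q_def using Y_le[OF \<omega>] k4 l p0 dir_le_1[OF t \<omega>] \<Delta>_bound[OF t \<omega>]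
        by (intro mult_left_mono exp_step_le) (auto simp: k_def)
      also have "\<dots> = Y \<omega> - k * Y \<omega> * (\<Delta> t \<omega> * dir t \<omega>) - k * (Y \<omega> * dir t \<omega> * \<xi> t \<omega>)
          + 90 * (W \<omega> * exp \<bar>\<xi> t \<omega>\<bar>)"
        by (simp add: W_def algebra_simps)
      also have "\<dots> \<le> R \<omega>"
      proof -
        have "k * Y \<omega> * (\<gamma>1 * \<sigma> t * (dir t \<omega>)\<^sup>2)
            \<le> k * Y \<omega> * ((\<Delta> t \<omega> + (f (c t) - f (c t * (1 - gap t \<omega>)))) * dir t \<omega>)"
          using drift_pointwise[OF t \<omega> gapG[OF True]] k0 Y_le[OF \<omega>] by (intro mult_left_mono) auto
        thus ?thesis by (simp add: R_def D_def algebra_simps)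
      qed
      finally show ?thesis using True by simp
    qed
  qed
  also have "(\<integral>\<omega>. R \<omega> \<partial>M) = (\<integral>\<omega>. Y \<omega> \<partial>M) - k * \<gamma>1 * \<sigma> t * (\<integral>\<omega>. Y \<omega> * V \<omega> \<partial>M)
      + 90 * (\<integral>\<omega>. W \<omega> * exp \<bar>\<xi> t \<omega>\<bar> \<partial>M)"
    unfolding R_def using int_Y int_Ddir int_Ydir2 noise1 noise2(1)
      direction_mean[OF t D_past D_le] direction_second_moment[OF t Y_past Y_le]
    by (simp add: V_def)
  also have "\<dots> \<le> (\<integral>\<omega>. Y \<omega> \<partial>M) - k * \<gamma>1 * \<sigma> t * (\<integral>\<omega>. Y \<omega> * V \<omega> \<partial>M) + 90 * (4 * (\<integral>\<omega>. W \<omega> \<partial>M))"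
    using noise2(2) by simp
  also have "(\<integral>\<omega>. W \<omega> \<partial>M) = (\<integral>\<omega>. k\<^sup>2 * (Y \<omega> * (dir t \<omega>)\<^sup>2) + k * p t * Y \<omega> \<partial>M)"
    by (intro Bochner_Integration.integral_cong) (auto simp: W_def algebra_simps)
  also have "\<dots> = k\<^sup>2 * (\<integral>\<omega>. Y \<omega> * V \<omega> \<partial>M) + k * p t * (\<integral>\<omega>. Y \<omega> \<partial>M)"
    using int_Y int_Ydir2 direction_second_moment[OF t Y_past Y_le] by (simp add: V_def)
  also have "(\<integral>\<omega>. Y \<omega> \<partial>M) - k * \<gamma>1 * \<sigma> t * (\<integral>\<omega>. Y \<omega> * V \<omega> \<partial>M)
      + 90 * (4 * (k\<^sup>2 * (\<integral>\<omega>. Y \<omega> * V \<omega> \<partial>M) + k * p t * (\<integral>\<omega>. Y \<omega> \<partial>M)))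
    = (1 + 360 * (k * p t)) * (\<integral>\<omega>. Y \<omega> \<partial>M) - (k * \<gamma>1 * \<sigma> t - 360 * k\<^sup>2) * (\<integral>\<omega>. Y \<omega> * V \<omega> \<partial>M)"
    by (simp add: algebra_simps)
  also have "\<dots> = (\<integral>\<omega>. (1 + 360 * (k * p t)) * Y \<omega> - (k * \<gamma>1 * \<sigma> t - 360 * k\<^sup>2) * (Y \<omega> * V \<omega>) \<partial>M)"
    using int_Y int_YV by simp
  also have "\<dots> \<le> (\<integral>\<omega>. indicator G \<omega> * exp (l * ((1 - rate t) * gap t \<omega> + bias t)) \<partial>M)"
  proof (rule integral_mono)
    show "integrable M (\<lambda>\<omega>. (1 + 360 * (k * p t)) * Y \<omega> - (k * \<gamma>1 * \<sigma> t - 360 * k\<^sup>2) * (Y \<omega> * V \<omega>))"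
      using int_Y int_YV by simp
    show "integrable M (\<lambda>\<omega>. indicator G \<omega> * exp (l * ((1 - rate t) * gap t \<omega> + bias t)))"
    proof (rule integrable_bounded)
      fix \<omega> assume \<omega>: "\<omega> \<in> space M"
      have "(1 - rate t) * gap t \<omega> \<le> \<bar>1 - rate t\<bar> * 2"
        using gap_bounds[OF t \<omega>] by (intro mult_mono) auto
      hence "l * ((1 - rate t) * gap t \<omega> + bias t) \<le> l * (\<bar>1 - rate t\<bar> * 2 + bias t)"
        using l by (intro mult_left_mono) auto
      thus "\<bar>indicator G \<omega> * exp (l * ((1 - rate t) * gap t \<omega> + bias t))\<bar>
          \<le> exp (l * (\<bar>1 - rate t\<bar> * 2 + bias t))"
        by (auto split: split_indicator)
    qed measurable
    fix \<omega> assume \<omega>: "\<omega> \<in> space M"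
    show "(1 + 360 * (k * p t)) * Y \<omega> - (k * \<gamma>1 * \<sigma> t - 360 * k\<^sup>2) * (Y \<omega> * V \<omega>)
        \<le> indicator G \<omega> * exp (l * ((1 - rate t) * gap t \<omega> + bias t))"
    proof (cases "\<omega> \<in> G")
      case False
      thus ?thesis by (simp add: Y_def)
    next
      case True
      have h: "0 \<le> gap t \<omega>" "gap t \<omega> \<le> 1"
        using gap_bounds[OF t \<omega>] gapG[OF True] \<gamma>0_le by auto
      have "p t * p t \<le> (\<eta> t * \<gamma>2 * \<sigma> t) * (\<eta> t * \<gamma>2 * \<sigma> t)"
        using p_le p0 \<eta>_pos[OF t] \<gamma>2_pos \<sigma>01 by (intro mult_mono) auto
      hence "l * (360 * (p t * p t)) \<le> l * (360 * ((\<eta> t * \<gamma>2 * \<sigma> t) * (\<eta> t * \<gamma>2 * \<sigma> t)))"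
        using l by (intro mult_left_mono) auto
      hence b: "360 * (k * p t) \<le> l * bias t"
        by (simp add: k_def bias_def power2_eq_square algebra_simps)
      \<comment> \<open>V = gap (2 - gap) / (d - 1), and on \<open>G\<close> the factor 2 - gap is
        at least 1.\<close>
      have "gap t \<omega> / real d \<le> V \<omega>"
      proof -
        have "V \<omega> = gap t \<omega> * (2 - gap t \<omega>) / (real d - 1)"
          by (simp add: V_def power2_eq_square algebra_simps)
        also have "\<dots> \<ge> gap t \<omega> * 1 / real d"
          using h dim by (intro frac_le mult_left_mono) auto
        finally show ?thesis by simp
      qed
      moreover have "l * (\<eta> t * \<gamma>1 * \<sigma> t) * (\<gamma>1 * \<sigma> t / 2) \<le> k * (\<gamma>1 * \<sigma> t / 2)"
        unfolding k_def using p_ge l \<gamma>1_pos \<sigma>01 by (intro mult_right_mono mult_left_mono) auto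
      moreover have "k * 360 * k \<le> k * (\<gamma>1 * \<sigma> t / 2)"
        using k720 k0 by (simp add: mult.assoc)
      hence kk: "k * (\<gamma>1 * \<sigma> t / 2) \<le> k * \<gamma>1 * \<sigma> t - 360 * k\<^sup>2"
        by (simp add: power2_eq_square algebra_simps)
      moreover have "0 \<le> k * (\<gamma>1 * \<sigma> t / 2)" using k0 \<gamma>1_pos \<sigma>01 by simp
      ultimately have "l * (\<eta> t * \<gamma>1 * \<sigma> t) * (\<gamma>1 * \<sigma> t / 2) * (gap t \<omega> / real d)
          \<le> (k * \<gamma>1 * \<sigma> t - 360 * k\<^sup>2) * V \<omega>"
        using h by (intro mult_mono) (linarith | simp)+
      hence "l * (rate t * gap t \<omega>) \<le> (k * \<gamma>1 * \<sigma> t - 360 * k\<^sup>2) * V \<omega>"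
        by (simp add: rate_def power2_eq_square field_simps)
      hence "1 + 360 * (k * p t) - (k * \<gamma>1 * \<sigma> t - 360 * k\<^sup>2) * V \<omega> \<le> 1 + (l * bias t - l * (rate t * gap t \<omega>))"
        using b by linarith
      also have "\<dots> \<le> exp (l * bias t - l * (rate t * gap t \<omega>))" by (rule exp_ge_add_one_self)
      finally have "exp (l * gap t \<omega>) * (1 + 360 * (k * p t) - (k * \<gamma>1 * \<sigma> t - 360 * k\<^sup>2) * V \<omega>)
          \<le> exp (l * gap t \<omega>) * exp (l * bias t - l * (rate t * gap t \<omega>))"
        by (intro mult_left_mono) auto
      also have "\<dots> = exp (l * ((1 - rate t) * gap t \<omega> + bias t))"
        by (simp add: algebra_simps flip: exp_add)
      finally show ?thesis
        using True by (simp add: Y_def algebra_simps)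
    qed
  qed
  finally show ?thesis .
qed

text \<open>
  The recursion is stable for the inverse temperature \<open>\<kappa> / \<eta> t\<close>: the growth of \<open>\<kappa> / \<eta> t\<close> is absorbed by
  the contraction \<open>1 - rate t\<close>, so one exponential moment, centred at a multiple of \<open>\<eta> t\<close>, controls
  the gap at every time.
\<close>

theorem gap_high_probability:
  assumes antimono: "\<And>t. t \<ge> 1 \<Longrightarrow> \<eta> (Suc t) \<le> \<eta> t"
    and slow: "\<And>t. t \<ge> 1 \<Longrightarrow> (1 - rate t / 2) * \<eta> t \<le> \<eta> (Suc t)"
    and rate_le: "\<And>t. t \<ge> 1 \<Longrightarrow> rate t \<le> 1"
    and \<kappa>: "0 < \<kappa>" "8 * (\<kappa> * \<gamma>2) \<le> 1" "1440 * (\<kappa> * \<gamma>2) \<le> \<gamma>1"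
    and bias_le: "\<And>t. t \<ge> 1 \<Longrightarrow> bias t \<le> rate t / 2 * (\<gamma>0 / (4 * \<eta> 1) * \<eta> t)"
    and L: "0 \<le> L" "exp (- L) \<le> \<delta>" "L * \<eta> 1 / \<kappa> \<le> \<gamma>0 / 4"
    and init: "\<And>\<omega>. \<omega> \<in> space M \<Longrightarrow> gap 1 \<omega> \<le> \<gamma>0 / 4"
    and T: "T \<ge> 1"
  shows "1 - \<delta> * real T
    \<le> prob {\<omega> \<in> space M. \<forall>s\<in>{1..T}. gap s \<omega> \<le> (\<gamma>0 / (4 * \<eta> 1) + L / \<kappa>) * \<eta> s \<and> gap s \<omega> \<le> \<gamma>0 / 2}"
proof -
  define x where "x s = (\<gamma>0 / (4 * \<eta> 1) + L / \<kappa>) * \<eta> s" for s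
  define y where "y s = \<gamma>0 / (4 * \<eta> 1) * \<eta> s" for s
  define lam where "lam s = \<kappa> / \<eta> s" for s
  define G where "G t = {\<omega> \<in> space M. \<forall>s\<in>{1..t}. gap s \<omega> \<le> x s}" for t
  define U where "U t = (\<integral>\<omega>. indicator (G t) \<omega> * exp (lam t * (gap t \<omega> - y t)) \<partial>M)" for t
  \<comment> \<open>The event lags one step behind the gap: \<open>exp_gap_one_step\<close> needs a
    past-measurable event, and a first exit at time \<open>Suc t\<close> happens inside
    \<open>G t\<close>. Since \<open>G\<close> decreases,
    \<open>U (Suc t) \<le> U' t\<close>.\<close>
  define U' where "U' t = (\<integral>\<omega>. indicator (G t) \<omega> * exp (lam (Suc t) * (gap (Suc t) \<omega> - y (Suc t))) \<partial>M)" for t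
  have \<eta>1: "0 < \<eta> 1" by (rule \<eta>_pos) simp
  have \<eta>_le: "\<eta> t \<le> \<eta> 1" if "t \<ge> 1" for t
    using that by (induction t rule: dec_induct) (auto intro: order_trans[OF antimono])
  have x_le: "x t \<le> \<gamma>0 / 2" if "t \<ge> 1" for t
  proof -
    have "x t \<le> (\<gamma>0 / (4 * \<eta> 1) + L / \<kappa>) * \<eta> 1"
      unfolding x_def using \<eta>_le[OF that] \<eta>1 \<gamma>0_pos L \<kappa> by (intro mult_left_mono) auto
    also have "\<dots> = \<gamma>0 / 4 + L * \<eta> 1 / \<kappa>" using \<eta>1 by (simp add: field_simps)
    finally show ?thesis using L(3) by linarith
  qed
  have lam_pos: "0 < lam t" if "t \<ge> 1" for t using \<eta>_pos[OF that] \<kappa> by (simp add: lam_def)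
  have lam_xy: "lam t * (x t - y t) = L" if "t \<ge> 1" for t
    using \<eta>_pos[OF that] \<kappa> by (simp add: lam_def x_def y_def algebra_simps)
  have G_past: "G t \<in> sets (\<F> t)" for t
  proof -
    have "G t = space (\<F> t) \<inter> (\<Inter>s\<in>{1..t}. {\<omega> \<in> space (\<F> t). gap s \<omega> \<le> x s})"
      by (auto simp: G_def)
    also have "\<dots> \<in> sets (\<F> t)"
    proof (cases "t \<ge> 1")
      case True
      have "{\<omega> \<in> space (\<F> t). gap s \<omega> \<le> x s} \<in> sets (\<F> t)" if "s \<in> {1..t}" for s
      proof -
        have [measurable]: "gap s \<in> borel_measurable (\<F> t)" using that by (intro gap_past) auto
        show ?thesis by measurable
      qed
      thus ?thesis using True by (intro sets.Int sets.top sets.finite_INT) auto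
    qed (use sets.top[of "\<F> t"] in simp)
    finally show ?thesis .
  qed
  have G_M [measurable]: "G t \<in> sets M" if "t \<ge> 1" for t
    using G_past[of t] subalgebra_past(1)[OF that] by (auto simp: subalgebra_def)
  have int: "integrable M (\<lambda>\<omega>. indicator (G t) \<omega> * exp (b * (gap s \<omega> - z)))" if "t \<ge> 1" "s \<ge> 1" "b > 0" for b t s z
  proof (rule integrable_bounded)
    note [measurable] = G_M[OF that(1)] measurable_gap[OF that(2)]
    show "(\<lambda>\<omega>. indicator (G t) \<omega> * exp (b * (gap s \<omega> - z))) \<in> borel_measurable M" by measurable
    fix \<omega> assume \<omega>: "\<omega> \<in> space M"
    have "b * (gap s \<omega> - z) \<le> b * (2 - z)"
      using gap_bounds(2)[OF that(2) \<omega>] that(3) by (intro mult_left_mono) auto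
    thus "\<bar>indicator (G t) \<omega> * exp (b * (gap s \<omega> - z))\<bar> \<le> exp (b * (2 - z))"
      by (auto split: split_indicator)
  qed
  have step: "U' t \<le> 1" if t: "t \<ge> 1" and U: "U t \<le> 1" for t
  proof -
    define l where "l = lam (Suc t)"
    define u where "u = (1 - rate t) * \<eta> t / \<eta> (Suc t)"
    have \<eta>t: "0 < \<eta> t" "0 < \<eta> (Suc t)" using \<eta>_pos t by auto
    have l0: "0 < l" unfolding l_def by (rule lam_pos) simp
    have rate0: "0 \<le> rate t" using \<eta>t by (simp add: rate_def)
    \<comment> \<open>A step size can at most halve in one step. This factor 2 separates the bounds
      8 and 1440 assumed for \<kappa> from the 4 and 720 of \<open>exp_gap_one_step\<close>.\<close>
    have "1 / 2 * \<eta> t \<le> (1 - rate t / 2) * \<eta> t"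
      using rate_le[OF t] \<eta>t by (intro mult_right_mono) auto
    hence "\<eta> t \<le> 2 * \<eta> (Suc t)" using slow[OF t] by linarith
    hence "\<eta> t / \<eta> (Suc t) \<le> 2"
      using \<eta>t by (simp add: divide_le_eq)
    hence "\<kappa> * \<gamma>2 * (\<eta> t / \<eta> (Suc t)) \<le> \<kappa> * \<gamma>2 * 2"
      using \<kappa> \<gamma>2_pos by (intro mult_left_mono) auto
    hence lg: "l * \<eta> t * \<gamma>2 \<le> 2 * (\<kappa> * \<gamma>2)" by (simp add: l_def lam_def mult_ac)
    have "(1 - rate t) * \<eta> t \<le> (1 - rate t / 2) * \<eta> t"
      using rate0 \<eta>t by (intro mult_right_mono) auto
    hence "(1 - rate t) * \<eta> t \<le> \<eta> (Suc t)" using slow[OF t] by linarith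
    hence u01: "0 \<le> u" "u \<le> 1"
      using rate_le[OF t] \<eta>t by (auto simp: u_def)
    have lu: "l * (1 - rate t) = u * lam t"
      using \<eta>t by (simp add: l_def lam_def u_def)
    define k where "k = \<gamma>0 / (4 * \<eta> 1)"
    have "k * ((1 - rate t / 2) * \<eta> t) \<le> k * \<eta> (Suc t)"
      using slow[OF t] \<gamma>0_pos \<eta>1 by (intro mult_left_mono) (auto simp: k_def)
    moreover have "bias t \<le> rate t / 2 * (k * \<eta> t)"
      unfolding k_def by (rule bias_le[OF t])
    \<comment> \<open>Half of the contraction compensates the decrease of the centre
      \<open>y\<close>, the other half the bias.\<close>
    ultimately have yy: "bias t - y (Suc t) \<le> - (1 - rate t) * y t"
      unfolding y_def k_def[symmetric] by (simp add: algebra_simps)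
    have "U' t = exp (- l * y (Suc t)) * (\<integral>\<omega>. indicator (G t) \<omega> * exp (l * gap (Suc t) \<omega>) \<partial>M)"
      unfolding U'_def Bochner_Integration.integral_mult_right_zero[symmetric]
      by (intro Bochner_Integration.integral_cong)
         (auto simp: l_def algebra_simps simp flip: exp_add split: split_indicator)
    also have "\<dots> \<le> exp (- l * y (Suc t))
        * (\<integral>\<omega>. indicator (G t) \<omega> * exp (l * ((1 - rate t) * gap t \<omega> + bias t)) \<partial>M)"
    proof (intro mult_left_mono exp_gap_one_step[OF t G_past _ l0])
      fix \<omega> assume "\<omega> \<in> G t"
      hence "gap t \<omega> \<le> x t" using t by (simp add: G_def)
      thus "gap t \<omega> \<le> \<gamma>0 / 2" using x_le[OF t] by linarith
    qed (use lg \<kappa> in auto)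
    also have "\<dots> = (\<integral>\<omega>. indicator (G t) \<omega> * exp (l * ((1 - rate t) * gap t \<omega> + (bias t - y (Suc t)))) \<partial>M)"
      unfolding Bochner_Integration.integral_mult_right_zero[symmetric]
      by (intro Bochner_Integration.integral_cong)
         (auto simp: algebra_simps simp flip: exp_add split: split_indicator)
    \<comment> \<open>Outside \<open>G t\<close> the left integrand is 0 and the right one is 1 - u
      \<ge> 0, so the chord bound survives the restriction to \<open>G t\<close>.\<close>
    also have "\<dots> \<le> (\<integral>\<omega>. (1 - u) + u * (indicator (G t) \<omega> * exp (lam t * (gap t \<omega> - y t))) \<partial>M)"
    proof (rule integral_mono_AE')
      show "integrable M (\<lambda>\<omega>. (1 - u) + u * (indicator (G t) \<omega> * exp (lam t * (gap t \<omega> - y t))))"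
        using int[OF t t lam_pos[OF t]] by simp
      show "AE \<omega> in M. indicator (G t) \<omega> * exp (l * ((1 - rate t) * gap t \<omega> + (bias t - y (Suc t))))
          \<le> (1 - u) + u * (indicator (G t) \<omega> * exp (lam t * (gap t \<omega> - y t)))"
      proof (rule AE_I2)
        fix \<omega> assume \<omega>: "\<omega> \<in> space M"
        have "l * ((1 - rate t) * gap t \<omega> + (bias t - y (Suc t))) \<le> l * ((1 - rate t) * gap t \<omega> + - (1 - rate t) * y t)"
          using l0 yy by (intro mult_left_mono add_left_mono) auto
        also have "\<dots> = l * (1 - rate t) * (gap t \<omega> - y t)" by (simp add: algebra_simps)
        also have "\<dots> = u * (lam t * (gap t \<omega> - y t))" unfolding lu by simp
        finally have "exp (l * ((1 - rate t) * gap t \<omega> + (bias t - y (Suc t)))) \<le> exp (u * (lam t * (gap t \<omega> - y t)))"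
          by simp
        also have "\<dots> \<le> 1 - u + u * exp (lam t * (gap t \<omega> - y t))" by (rule exp_convex_le[OF u01])
        finally show "indicator (G t) \<omega> * exp (l * ((1 - rate t) * gap t \<omega> + (bias t - y (Suc t))))
          \<le> (1 - u) + u * (indicator (G t) \<omega> * exp (lam t * (gap t \<omega> - y t)))"
          using u01 by (auto split: split_indicator)
      qed
    qed (use u01 in \<open>auto intro!: add_nonneg_nonneg\<close>)
    also have "\<dots> = 1 - u + u * U t"
      using int[OF t t lam_pos[OF t]] by (simp add: U_def prob_space)
    also have "\<dots> \<le> 1 - u + u * 1"
      using U u01 by (intro add_left_mono mult_left_mono) auto
    finally show ?thesis by simp
  qed
  have U1: "U 1 \<le> 1"
  proof -
    have "U 1 \<le> (\<integral>\<omega>. 1 \<partial>M)"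
      unfolding U_def
    proof (rule integral_mono)
      fix \<omega> assume \<omega>: "\<omega> \<in> space M"
      have "lam 1 * (gap 1 \<omega> - y 1) \<le> 0"
        using init[OF \<omega>] lam_pos[of 1] \<eta>1 by (intro mult_nonneg_nonpos) (auto simp: y_def)
      thus "indicator (G 1) \<omega> * exp (lam 1 * (gap 1 \<omega> - y 1)) \<le> 1"
        by (auto split: split_indicator)
    qed (use int[of 1 1] lam_pos[of 1] in auto)
    thus ?thesis by (simp add: prob_space)
  qed
  have U: "U t \<le> 1" if "t \<ge> 1" for t
    using that
  proof (induction t rule: dec_induct)
    case base
    show ?case using U1 by simp
  next
    case (step t)
    have t: "t \<ge> 1" "Suc t \<ge> 1" using step.hyps by auto
    have "U (Suc t) \<le> U' t"
      unfolding U_def U'_def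
      using t lam_pos[OF t(2)]
      by (intro integral_mono int mult_right_mono) (auto simp: G_def split: split_indicator)
    also have "\<dots> \<le> 1" by (rule \<open>\<And>t. 1 \<le> t \<Longrightarrow> U t \<le> 1 \<Longrightarrow> U' t \<le> 1\<close>[OF t(1) step.IH])
    finally show ?case .
  qed
  have prob_G: "1 - \<delta> * real (t - 1) \<le> prob (G t)" if "t \<ge> 1" for t
    using that
  proof (induction t rule: dec_induct)
    case base
    \<comment> \<open>No probability is spent at time 1, hence the count
      \<open>t - 1\<close>.\<close>
    have "G 1 = space M"
      using init L(1) \<kappa> \<eta>1 by (auto simp: G_def x_def algebra_simps intro: order_trans add_increasing2)
    thus ?case by (simp add: prob_space)
  next
    case (step t)
    have t: "t \<ge> 1" "Suc t \<ge> 1" using step.hyps by auto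
    note [measurable] = G_M[OF t(1)] measurable_gap[OF t(2)]
    \<comment> \<open>The first exit at time \<open>Suc t\<close>. On it the exponent exceeds
      \<open>L\<close>, and \<open>U' t \<le> 1\<close> gives probability at most exp(-L).\<close>
    define N where "N = G t \<inter> {\<omega> \<in> space M. x (Suc t) < gap (Suc t) \<omega>}"
    have N [measurable]: "N \<in> sets M" unfolding N_def by measurable
    have "exp L * prob N = (\<integral>\<omega>. exp L * indicator N \<omega> \<partial>M)" by simp
    also have "\<dots> \<le> U' t"
      unfolding U'_def
    proof (rule integral_mono)
      show "integrable M (\<lambda>\<omega>. exp L * indicator N \<omega>)" by (intro integrable_bounded[where B = "exp L"]) (auto split: split_indicator)
      show "integrable M (\<lambda>\<omega>. indicator (G t) \<omega> * exp (lam (Suc t) * (gap (Suc t) \<omega> - y (Suc t))))"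
        by (rule int[OF t lam_pos[OF t(2)]])
      fix \<omega> assume "\<omega> \<in> space M"
      show "exp L * indicator N \<omega> \<le> indicator (G t) \<omega> * exp (lam (Suc t) * (gap (Suc t) \<omega> - y (Suc t)))"
      proof (cases "\<omega> \<in> N")
        case True
        hence "lam (Suc t) * (x (Suc t) - y (Suc t)) \<le> lam (Suc t) * (gap (Suc t) \<omega> - y (Suc t))"
          using lam_pos[OF t(2)] by (intro mult_left_mono) (auto simp: N_def)
        thus ?thesis using True lam_xy[OF t(2)] by (simp add: N_def)
      qed simp
    qed
    also have "\<dots> \<le> 1" by (rule \<open>\<And>t. 1 \<le> t \<Longrightarrow> U t \<le> 1 \<Longrightarrow> U' t \<le> 1\<close>[OF t(1) U[OF t(1)]])
    finally have "prob N \<le> exp (- L)" by (simp add: exp_minus field_simps)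
    hence "prob N \<le> \<delta>" using L(2) by simp
    moreover have "G (Suc t) = G t - N"
      using t by (auto simp: G_def N_def atLeastAtMostSuc_conv not_less)
    hence "prob (G (Suc t)) = prob (G t) - prob N"
      by (simp add: finite_measure_Diff N_def)
    moreover have "\<delta> * real (Suc t - 1) = \<delta> * real (t - 1) + \<delta>"
      using t by (simp add: of_nat_diff algebra_simps)
    ultimately show ?case using step.IH by linarith
  qed
  have "0 \<le> \<delta>" using L(2) exp_gt_zero[of "- L"] by linarith
  hence "\<delta> * real (T - 1) \<le> \<delta> * real T" by (intro mult_left_mono) auto
  hence "1 - \<delta> * real T \<le> prob (G T)" using prob_G[OF T] by linarith
  also have "G T = {\<omega> \<in> space M. \<forall>s\<in>{1..T}. gap s \<omega> \<le> x s \<and> gap s \<omega> \<le> \<gamma>0 / 2}"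
  proof -
    have "gap s \<omega> \<le> \<gamma>0 / 2" if "gap s \<omega> \<le> x s" "s \<ge> 1" for s \<omega>
      using that x_le[of s] by linarith
    thus ?thesis unfolding G_def by (auto simp del: One_nat_def)
  qed
  finally show ?thesis unfolding x_def .
qed

end

subsection \<open>Schedules\<close>

text \<open>Both schedules multiply the decaying branch by a constant and divide the cap by
  \<open>b\<close> times a logarithm; \<open>K\<close> dominates either distortion.\<close>

lemma within_factor_min:
  assumes "1 \<le> A" "A \<le> K" "1 \<le> B" "B \<le> K" "0 \<le> x" "0 \<le> y"
  shows "within_factor K (min (A * x) (y / B)) (min x y)"
proof -
  have K: "1 \<le> K" using assms by simp
  have 1: "min x y / K \<le> A * x"
  proof -
    have "min x y / K \<le> x / 1" using assms K by (intro frac_le) auto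
    also have "\<dots> \<le> A * x" using assms mult_right_mono[of 1 A x] by simp
    finally show ?thesis .
  qed
  have 2: "min x y / K \<le> y / B" using assms by (intro frac_le) auto
  have 3: "min (A * x) (y / B) \<le> K * x"
    using assms mult_right_mono[of A K x] by linarith
  have "y / B \<le> y / 1" using assms by (intro frac_le) auto
  hence 4: "min (A * x) (y / B) \<le> K * y"
    using assms K mult_right_mono[of 1 K y] by linarith
  show ?thesis
    unfolding within_factor_def using 1 2 3 4 by (auto simp: min_def)
qed

text \<open>Each term is at most 2 (sqrt t - sqrt (t - 1)), and these telescope.\<close>

lemma sum_inverse_sqrt_le: "(\<Sum>t=1..T. 1 / sqrt (real t)) \<le> 2 * sqrt (real T)"
proof (induction T)
  case (Suc T)
  let ?a = "sqrt (real T)" and ?b = "sqrt (real (Suc T))"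
  have b: "0 < ?b" "?a \<le> ?b" "0 \<le> ?a" by auto
  have "?b * ?b - ?a * ?a = 1" by simp
  hence "1 = (?b - ?a) * (?b + ?a)" by (simp add: algebra_simps)
  also have "\<dots> \<le> (?b - ?a) * (2 * ?b)" using b by (intro mult_left_mono) auto
  finally have "1 / ?b \<le> 2 * ?b - 2 * ?a" using b(1) by (simp add: field_simps)
  thus ?case using Suc.IH by simp
qed simp

text \<open>The value of \<open>L\<close> in \<open>gap_high_probability\<close>: at least 1 and
  with exp(-L) \<le> \<delta> for every positive \<delta>, including \<delta> \<ge> 1, and bounded
  by \<open>logs\<close>.\<close>

definition log_term :: "real \<Rightarrow> real" where
  "log_term \<delta> = 1 + ln (1 + 1 / \<delta>)"

lemma log_term_ge_1: "\<delta> > 0 \<Longrightarrow> 1 \<le> log_term \<delta>"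
  by (simp add: log_term_def)

lemma exp_log_term_le: "\<delta> > 0 \<Longrightarrow> exp (- log_term \<delta>) \<le> \<delta>"
proof -
  assume "\<delta> > 0"
  have "exp (- log_term \<delta>) \<le> exp (- ln (1 + 1 / \<delta>))" by (simp add: log_term_def)
  also have "\<dots> = 1 / (1 + 1 / \<delta>)" using \<open>\<delta> > 0\<close> by (simp add: exp_minus field_simps add_pos_pos)
  also have "\<dots> \<le> \<delta>" using \<open>\<delta> > 0\<close> by (simp add: field_simps)
  finally show ?thesis .
qed

section \<open>Constants depending only on the link parameters\<close>

locale link_constants =
  fixes \<gamma>0 \<gamma>1 \<gamma>2 :: real
  assumes \<gamma>0: "0 < \<gamma>0" "\<gamma>0 \<le> 1 / 10" and \<gamma>1: "0 < \<gamma>1" and \<gamma>2: "0 < \<gamma>2"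
begin

definition s0 :: real where "s0 = \<gamma>0 / 100"

definition \<kappa> :: real where "\<kappa> = min (1 / (8 * \<gamma>2)) (\<gamma>1 / (1440 * \<gamma>2))"

text \<open>The sum of all lower bounds required of \<open>b\<close>. In order: b \<ge> 1; the bias
  condition, with 5760 = 16 * 360; a first step size small enough that L \<eta> / \<kappa> \<le>
  \<gamma>0 / 4; a contraction rate of at most 1; a rate of at least 2 / (t + 1) while the step size
  decreases.\<close>

definition b :: real where
  "b = 1 + 5760 * \<gamma>2\<^sup>2 / (\<gamma>1\<^sup>2 * \<gamma>0) + 4 / (\<kappa> * \<gamma>0) + \<gamma>1\<^sup>2 + 4 / (s0 * \<gamma>1\<^sup>2)"

text \<open>Collects the coefficient of \<eta> in the gap bound: with 1 / \<eta> 1 = b L d,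
  \<gamma>0 / (4 \<eta> 1) + L / \<kappa> is at most D L d.\<close>

definition D :: real where "D = \<gamma>0 * b / 4 + 1 / \<kappa>"

lemma s0: "0 < s0" "s0 \<le> 1"
  using \<gamma>0 by (auto simp: s0_def)

lemma \<kappa>: "0 < \<kappa>" "8 * (\<kappa> * \<gamma>2) \<le> 1" "1440 * (\<kappa> * \<gamma>2) \<le> \<gamma>1"
proof -
  show "0 < \<kappa>" using \<gamma>1 \<gamma>2 by (simp add: \<kappa>_def)
  have "\<kappa> \<le> 1 / (8 * \<gamma>2)" "\<kappa> \<le> \<gamma>1 / (1440 * \<gamma>2)" by (simp_all add: \<kappa>_def)
  thus "8 * (\<kappa> * \<gamma>2) \<le> 1" "1440 * (\<kappa> * \<gamma>2) \<le> \<gamma>1"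
    using \<gamma>2 by (simp_all add: field_simps)
qed

lemma b_ge: "1 \<le> b" "5760 * \<gamma>2\<^sup>2 / (\<gamma>1\<^sup>2 * \<gamma>0) \<le> b" "4 / (\<kappa> * \<gamma>0) \<le> b" "\<gamma>1\<^sup>2 \<le> b" "4 / (s0 * \<gamma>1\<^sup>2) \<le> b"
proof -
  have "0 \<le> 5760 * \<gamma>2\<^sup>2 / (\<gamma>1\<^sup>2 * \<gamma>0)" "0 \<le> 4 / (\<kappa> * \<gamma>0)" "0 \<le> \<gamma>1\<^sup>2" "0 \<le> 4 / (s0 * \<gamma>1\<^sup>2)"
    using \<gamma>0 \<kappa> s0 by simp_all
  thus "1 \<le> b" "5760 * \<gamma>2\<^sup>2 / (\<gamma>1\<^sup>2 * \<gamma>0) \<le> b" "4 / (\<kappa> * \<gamma>0) \<le> b" "\<gamma>1\<^sup>2 \<le> b" "4 / (s0 * \<gamma>1\<^sup>2) \<le> b"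
    unfolding b_def by linarith+
qed

lemma b_mult:
  "5760 * \<gamma>2\<^sup>2 \<le> b * (\<gamma>1\<^sup>2 * \<gamma>0)" "4 \<le> b * (\<kappa> * \<gamma>0)" "4 \<le> b * (s0 * \<gamma>1\<^sup>2)"
  using b_ge \<gamma>0 \<gamma>1 \<kappa> s0 by (simp_all add: divide_le_eq)

lemma D_pos: "0 < D"
  using \<gamma>0 b_ge \<kappa> by (simp add: D_def add_pos_pos)

text \<open>
  Both schedules of the theorem decrease only when the contraction rate is at least \<open>2 / (t + 1)\<close>,
  and then at most by the factor \<open>t / (t + 1)\<close>.
\<close>

lemma sgd_gap_bound:
  fixes M :: "'w measure" and d :: nat
  defines "gap \<equiv> \<lambda>\<theta>star \<theta> s \<omega>. 1 - ip d \<theta>star (\<theta> s \<omega>)"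
  assumes sgd: "interactive_sgd M d f f' \<eta> \<sigma> \<theta>star \<theta> Z \<xi> a r"
    and init: "\<forall>\<omega>\<in>space M. ip d (\<theta> 1 \<omega>) \<theta>star \<ge> 1 - \<gamma>0 / 4"
    and link: "link_function \<gamma>0 \<gamma>1 \<gamma>2 f f'" and d: "d \<ge> 2" and \<delta>: "\<delta> > 0"
    and \<eta>1: "\<eta> 1 = 1 / real d / (b * log_term \<delta>)"
    and pos: "\<forall>t\<ge>1. 0 < \<eta> t" and decr: "\<forall>t\<ge>1. \<eta> (Suc t) \<le> \<eta> t"
    and slow_decr: "\<forall>t\<ge>1. \<eta> (Suc t) < \<eta> t \<longrightarrow>
      real t / (real t + 1) * \<eta> t \<le> \<eta> (Suc t) \<and>
      1 / (real t + 1) \<le> \<eta> t * (\<sigma> t)\<^sup>2 * \<gamma>1\<^sup>2 / (4 * real d)"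
    and \<sigma>_bounds: "\<forall>t\<ge>1. 0 < \<sigma> t \<and> (\<sigma> t)\<^sup>2 \<le> s0"
    and T: "T \<ge> 1"
  shows "1 - \<delta> * real T \<le> measure M {\<omega> \<in> space M. \<forall>s\<in>{1..T}.
      gap \<theta>star \<theta> s \<omega> \<le> D * log_term \<delta> * real d * \<eta> s \<and> gap \<theta>star \<theta> s \<omega> \<le> \<gamma>0 / 2}"
    and "\<And>s. s \<ge> 1 \<Longrightarrow> gap \<theta>star \<theta> s \<in> borel_measurable M"
    and "\<And>s \<omega>. s \<ge> 1 \<Longrightarrow> \<omega> \<in> space M \<Longrightarrow> 0 \<le> gap \<theta>star \<theta> s \<omega> \<and> gap \<theta>star \<theta> s \<omega> \<le> 2"
proof -
  note \<eta>_pos = pos[rule_format] and \<eta>_Suc = decr[rule_format] and slow = slow_decr[rule_format]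
    and \<sigma> = \<sigma>_bounds[rule_format]
  interpret interactive_sgd M d f f' \<eta> \<sigma> \<theta>star \<theta> Z \<xi> a r by (rule sgd)
  interpret S: linked_sgd M d f f' \<eta> \<sigma> \<theta>star \<theta> Z \<xi> a r \<gamma>0 \<gamma>1 \<gamma>2
    using link \<gamma>0 \<gamma>1 \<gamma>2 d \<eta>_pos \<sigma> by unfold_locales (auto simp: s0_def)
  have gap: "gap \<theta>star \<theta> = S.gap" by (simp add: fun_eq_iff gap_def S.gap_def)
  define L where "L = log_term \<delta>"
  have L1: "1 \<le> L" unfolding L_def by (rule log_term_ge_1[OF \<delta>])
  have bL: "b \<le> b * L" using mult_left_mono[OF L1, of b] b_ge(1) by simp
  have d1: "1 \<le> real d" using d by simp
  have \<eta>_le: "\<eta> t \<le> \<eta> 1" if "t \<ge> 1" for t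
    using that by (induction t rule: dec_induct) (auto intro: order_trans[OF \<eta>_Suc])
  have \<eta>1': "\<eta> 1 * (b * L * real d) = 1"
    unfolding \<eta>1 L_def[symmetric] using b_ge(1) L1 d1 by simp
  have \<eta>1_pos: "0 < \<eta> 1" by (rule \<eta>_pos) simp
  have inv_\<eta>1: "1 / \<eta> 1 = b * L * real d"
    using \<eta>1' \<eta>1_pos by (simp add: field_simps)
  have rate_le: "S.rate t \<le> 1" if t: "t \<ge> 1" for t
  proof -
    have "\<eta> t * (\<sigma> t)\<^sup>2 * \<gamma>1\<^sup>2 \<le> \<eta> 1 * 1 * (b * L * real d)"
    proof (intro mult_mono)
      show "(\<sigma> t)\<^sup>2 \<le> 1" using \<sigma>[OF t] s0 by simp
      have "b * L * 1 \<le> b * L * real d" using d1 b_ge(1) L1 by (intro mult_left_mono) auto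
      thus "\<gamma>1\<^sup>2 \<le> b * L * real d" using b_ge(4) bL by linarith
    qed (use \<eta>_le[OF t] \<eta>1_pos in auto)
    thus ?thesis using \<eta>1' d1 by (simp add: S.rate_def divide_le_eq)
  qed
  have bias_le: "S.bias t \<le> S.rate t / 2 * (\<gamma>0 / (4 * \<eta> 1) * \<eta> t)" if t: "t \<ge> 1" for t
  proof -
    have "5760 * \<gamma>2\<^sup>2 \<le> b * L * (\<gamma>1\<^sup>2 * \<gamma>0)"
      using b_mult(1) mult_right_mono[OF bL, of "\<gamma>1\<^sup>2 * \<gamma>0"] \<gamma>0 by (auto intro: order_trans)
    hence "(5760 * \<gamma>2\<^sup>2) * ((\<eta> t)\<^sup>2 * (\<sigma> t)\<^sup>2 / 16) \<le> (b * L * (\<gamma>1\<^sup>2 * \<gamma>0)) * ((\<eta> t)\<^sup>2 * (\<sigma> t)\<^sup>2 / 16)"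
      by (intro mult_right_mono) auto
    also have "\<dots> = S.rate t / 2 * (\<gamma>0 / 4 * (b * L * real d) * \<eta> t)"
      using d1 by (simp add: S.rate_def power2_eq_square field_simps)
    also have "\<dots> = S.rate t / 2 * (\<gamma>0 / (4 * \<eta> 1) * \<eta> t)"
      unfolding inv_\<eta>1[symmetric] by simp
    finally show ?thesis by (simp add: S.bias_def)
  qed
  have slow': "(1 - S.rate t / 2) * \<eta> t \<le> \<eta> (Suc t)" if t: "t \<ge> 1" for t
  proof (cases "\<eta> (Suc t) < \<eta> t")
    case True
    have "1 - S.rate t / 2 \<le> 1 - 1 / (real t + 1)"
      using slow[OF t True] by (simp add: S.rate_def)
    also have "\<dots> = real t / (real t + 1)" by (simp add: field_simps)
    finally have "(1 - S.rate t / 2) * \<eta> t \<le> real t / (real t + 1) * \<eta> t"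
      using \<eta>_pos[OF t] by (intro mult_right_mono) auto
    thus ?thesis using slow[OF t True] by linarith
  next
    case False
    have "0 \<le> S.rate t" using \<eta>_pos[OF t] by (simp add: S.rate_def)
    hence "(1 - S.rate t / 2) * \<eta> t \<le> 1 * \<eta> t"
      using \<eta>_pos[OF t] by (intro mult_right_mono) auto
    thus ?thesis using False by simp
  qed
  have L\<eta>: "L * \<eta> 1 / \<kappa> \<le> \<gamma>0 / 4"
  proof -
    have "4 * L \<le> b * (\<kappa> * \<gamma>0) * L"
      using b_mult(2) L1 by (intro mult_right_mono) auto
    also have "\<dots> \<le> b * (\<kappa> * \<gamma>0) * L * real d"
      using mult_left_mono[OF d1, of "b * (\<kappa> * \<gamma>0) * L"] b_ge(1) \<kappa>(1) \<gamma>0 L1 by simp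
    finally have "4 * L * \<eta> 1 \<le> b * (\<kappa> * \<gamma>0) * L * real d * \<eta> 1"
      using \<eta>1_pos by (intro mult_right_mono) auto
    also have "\<dots> = \<kappa> * \<gamma>0 * (\<eta> 1 * (b * L * real d))" by (simp add: algebra_simps)
    finally have "4 * L * \<eta> 1 \<le> \<kappa> * \<gamma>0" unfolding \<eta>1' by simp
    thus ?thesis using \<kappa>(1) by (simp add: field_simps)
  qed
  have main: "1 - \<delta> * real T \<le> prob {\<omega> \<in> space M. \<forall>s\<in>{1..T}.
      S.gap s \<omega> \<le> (\<gamma>0 / (4 * \<eta> 1) + L / \<kappa>) * \<eta> s \<and> S.gap s \<omega> \<le> \<gamma>0 / 2}"
  proof (rule S.gap_high_probability[OF \<eta>_Suc slow' rate_le \<kappa> bias_le _ _ L\<eta> _ T])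
    show "0 \<le> L" using L1 by simp
    show "exp (- L) \<le> \<delta>" unfolding L_def by (rule exp_log_term_le[OF \<delta>])
    show "S.gap 1 \<omega> \<le> \<gamma>0 / 4" if "\<omega> \<in> space M" for \<omega>
      using init that by (auto simp: S.gap_def ip_commute[of d \<theta>star])
  qed
  have coeff: "\<gamma>0 / (4 * \<eta> 1) + L / \<kappa> \<le> D * L * real d"
  proof -
    have "L / \<kappa> * 1 \<le> L / \<kappa> * real d" using d1 L1 \<kappa>(1) by (intro mult_left_mono) auto
    moreover have "\<gamma>0 / (4 * \<eta> 1) = \<gamma>0 / 4 * (b * L * real d)"
      unfolding inv_\<eta>1[symmetric] by simp
    ultimately show ?thesis by (simp add: D_def algebra_simps)
  qed
  note main
  also have "prob {\<omega> \<in> space M. \<forall>s\<in>{1..T}.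
      S.gap s \<omega> \<le> (\<gamma>0 / (4 * \<eta> 1) + L / \<kappa>) * \<eta> s \<and> S.gap s \<omega> \<le> \<gamma>0 / 2}
    \<le> prob {\<omega> \<in> space M. \<forall>s\<in>{1..T}. S.gap s \<omega> \<le> D * L * real d * \<eta> s \<and> S.gap s \<omega> \<le> \<gamma>0 / 2}"
  proof (rule finite_measure_mono)
    have "S.gap s \<omega> \<le> D * L * real d * \<eta> s"
      if "S.gap s \<omega> \<le> (\<gamma>0 / (4 * \<eta> 1) + L / \<kappa>) * \<eta> s" "1 \<le> s" for s \<omega>
      using that(1) mult_right_mono[OF coeff, of "\<eta> s"] \<eta>_pos[OF that(2)] by linarith
    thus "{\<omega> \<in> space M. \<forall>s\<in>{1..T}.
      S.gap s \<omega> \<le> (\<gamma>0 / (4 * \<eta> 1) + L / \<kappa>) * \<eta> s \<and> S.gap s \<omega> \<le> \<gamma>0 / 2}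
      \<subseteq> {\<omega> \<in> space M. \<forall>s\<in>{1..T}. S.gap s \<omega> \<le> D * L * real d * \<eta> s \<and> S.gap s \<omega> \<le> \<gamma>0 / 2}"
      by auto
    have "{\<omega> \<in> space M. S.gap s \<omega> \<le> D * L * real d * \<eta> s \<and> S.gap s \<omega> \<le> \<gamma>0 / 2} \<in> sets M"
      if "s \<in> {1..T}" for s
    proof -
      have [measurable]: "S.gap s \<in> borel_measurable M" using that by (intro S.measurable_gap) simp
      show ?thesis by measurable
    qed
    thus "{\<omega> \<in> space M. \<forall>s\<in>{1..T}. S.gap s \<omega> \<le> D * L * real d * \<eta> s \<and> S.gap s \<omega> \<le> \<gamma>0 / 2} \<in> sets M"
      by (intro sets.sets_Collect_finite_All) auto
  qed
  finally show "1 - \<delta> * real T \<le> measure M {\<omega> \<in> space M. \<forall>s\<in>{1..T}.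
      gap \<theta>star \<theta> s \<omega> \<le> D * log_term \<delta> * real d * \<eta> s \<and> gap \<theta>star \<theta> s \<omega> \<le> \<gamma>0 / 2}"
    unfolding gap L_def .
  show "gap \<theta>star \<theta> s \<in> borel_measurable M" if "s \<ge> 1" for s
    unfolding gap by (rule S.measurable_gap[OF that])
  show "0 \<le> gap \<theta>star \<theta> s \<omega> \<and> gap \<theta>star \<theta> s \<omega> \<le> 2" if "s \<ge> 1" "\<omega> \<in> space M" for s \<omega>
    unfolding gap using S.gap_bounds[OF that] by simp
qed

text \<open>The cap \<open>v\<close> is constant, so the minimum can decrease strictly only by
  passing to, or staying on, the branch \<open>u\<close>.\<close>

lemma min_schedule_slow:
  assumes t: "t \<ge> 1" and \<eta>: "\<And>t. \<eta> t = min (u t) (v :: real)"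
    and u: "real t / (real t + 1) * u t \<le> u (Suc t)" "0 \<le> u t"
    and less: "\<eta> (Suc t) < \<eta> t"
  shows "\<eta> (Suc t) = u (Suc t)" "real t / (real t + 1) * \<eta> t \<le> \<eta> (Suc t)"
proof -
  show 1: "\<eta> (Suc t) = u (Suc t)" using less unfolding \<eta> by (auto simp: min_def split: if_splits)
  have "real t / (real t + 1) * \<eta> t \<le> real t / (real t + 1) * u t"
    unfolding \<eta> by (intro mult_left_mono) auto
  thus "real t / (real t + 1) * \<eta> t \<le> \<eta> (Suc t)" using u 1 by linarith
qed

lemma pure_exploration:
  fixes d :: nat and \<epsilon> \<delta> :: real
  assumes d: "d \<ge> 2" and \<epsilon>: "\<epsilon> > 0" and \<delta>: "\<delta> > 0" and link: "link_function \<gamma>0 \<gamma>1 \<gamma>2 f f'"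
  defines "C \<equiv> b * D + b + 1 / s0"
  shows "\<exists>\<eta> \<sigma>. schedules \<eta> \<sigma> \<and>
    (\<forall>t\<ge>1. within_factor (C * logs [real d, 1 / \<epsilon>, 1 / \<delta>, real t] ^ 1)
              (\<eta> t) (min (real d / real t) (1 / real d)) \<and>
           within_factor C ((\<sigma> t)\<^sup>2) 1) \<and>
    (\<exists>T\<ge>1. int T \<le> \<lceil>C * logs [real d, 1 / \<epsilon>, 1 / \<delta>] ^ 1 * ((real d)\<^sup>2 / \<epsilon>)\<rceil> \<and>
       (\<forall>(M::'w measure) \<theta>star \<theta> Z \<xi> a r.
          interactive_sgd M d f f' \<eta> \<sigma> \<theta>star \<theta> Z \<xi> a r \<and>
          (\<forall>\<omega>\<in>space M. ip d (\<theta> 1 \<omega>) \<theta>star \<ge> 1 - \<gamma>0 / 4) \<longrightarrow>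
          measure M {\<omega> \<in> space M. ip d \<theta>star (\<theta> T \<omega>) \<ge> 1 - \<epsilon>} \<ge> 1 - \<delta> * real T))"
proof -
  define L where "L = log_term \<delta>"
  \<comment> \<open>The cap gives the small first step demanded by \<open>sgd_gap_bound\<close>. On
    the other branch b \<ge> 4 / (s0 \<gamma>1^2) keeps half the contraction rate, \<eta> s0
    \<gamma>1^2 / (4 d), at least 1 / (t + 1).\<close>
  define \<eta> where "\<eta> t = min (b * (real d / real t)) (1 / real d / (b * L))" for t :: nat
  define \<sigma> where "\<sigma> = (\<lambda>t::nat. sqrt s0)"
  \<comment> \<open>Solves D L d * (b d / T) = \<epsilon>, the gap bound evaluated on the decaying
    branch.\<close>
  define T where "T = nat \<lceil>b * D * L * (real d)\<^sup>2 / \<epsilon>\<rceil>"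
  have L1: "1 \<le> L" unfolding L_def by (rule log_term_ge_1[OF \<delta>])
  have b1: "1 \<le> b" by (rule b_ge)
  have bL: "b \<le> b * L" using mult_left_mono[OF L1, of b] b1 by simp
  have d1: "1 \<le> real d" using d by simp
  have C: "b \<le> C" "b * D \<le> C" "1 / s0 \<le> C" "1 \<le> C"
  proof -
    have "0 < b * D" "0 < 1 / s0" using b1 D_pos s0 by simp_all
    thus "b \<le> C" "b * D \<le> C" "1 / s0 \<le> C" "1 \<le> C" using b1 unfolding C_def by linarith+
  qed
  have \<eta>_pos: "0 < \<eta> t" if "t \<ge> 1" for t
    using that d1 b1 L1 by (simp add: \<eta>_def)
  have \<sigma>2: "(\<sigma> t)\<^sup>2 = s0" for t using s0 by (simp add: \<sigma>_def)
  have logs3: "L \<le> logs [real d, 1 / \<epsilon>, 1 / \<delta>]" and logs4: "L \<le> logs [real d, 1 / \<epsilon>, 1 / \<delta>, real t]" for t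
    using d1 \<epsilon> \<delta> by (simp_all add: L_def logs_def log_term_def add_nonneg_nonneg)
  have factor: "within_factor (C * logs [real d, 1 / \<epsilon>, 1 / \<delta>, real t] ^ 1) (\<eta> t) (min (real d / real t) (1 / real d))"
    if "t \<ge> 1" for t
  proof -
    have "b * L \<le> C * logs [real d, 1 / \<epsilon>, 1 / \<delta>, real t]"
      using C(1,4) b1 L1 logs4[of t] by (intro mult_mono) auto
    thus ?thesis
      unfolding \<eta>_def power_one_right using b1 bL by (intro within_factor_min) (linarith | simp)+
  qed
  have T1: "1 \<le> T"
  proof -
    have "0 < b * D * L * (real d)\<^sup>2 / \<epsilon>" using b1 D_pos L1 d1 \<epsilon> by simp
    thus ?thesis unfolding T_def by linarith
  qed
  have T_ge: "b * D * L * (real d)\<^sup>2 / \<epsilon> \<le> real T"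
    unfolding T_def by linarith
  have T_le: "int T \<le> \<lceil>C * logs [real d, 1 / \<epsilon>, 1 / \<delta>] ^ 1 * ((real d)\<^sup>2 / \<epsilon>)\<rceil>"
  proof -
    have "0 \<le> b * D * L * (real d)\<^sup>2 / \<epsilon>" using b1 D_pos L1 \<epsilon> by simp
    hence "0 \<le> \<lceil>b * D * L * (real d)\<^sup>2 / \<epsilon>\<rceil>" by linarith
    hence "int T = \<lceil>b * D * L * ((real d)\<^sup>2 / \<epsilon>)\<rceil>" unfolding T_def by simp
    also have "\<dots> \<le> \<lceil>C * logs [real d, 1 / \<epsilon>, 1 / \<delta>] ^ 1 * ((real d)\<^sup>2 / \<epsilon>)\<rceil>"
      unfolding power_one_right using C(2,4) b1 D_pos L1 logs3 \<epsilon> by (intro ceiling_mono mult_mono) auto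
    finally show ?thesis .
  qed
  have "measure M {\<omega> \<in> space M. ip d \<theta>star (\<theta> T \<omega>) \<ge> 1 - \<epsilon>} \<ge> 1 - \<delta> * real T"
    if sgd: "interactive_sgd M d f f' \<eta> \<sigma> \<theta>star \<theta> Z \<xi> a r"
      and init: "\<forall>\<omega>\<in>space M. ip d (\<theta> 1 \<omega>) \<theta>star \<ge> 1 - \<gamma>0 / 4"
    for M :: "'w measure" and \<theta>star \<theta> Z \<xi> a r
  proof -
    interpret interactive_sgd M d f f' \<eta> \<sigma> \<theta>star \<theta> Z \<xi> a r by (rule sgd)
    have \<eta>1: "\<eta> 1 = 1 / real d / (b * log_term \<delta>)"
    proof -
      have "1 / real d / (b * L) \<le> 1 / 1 / 1"
        using d1 b1 bL by (intro frac_le) (linarith | simp)+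
      also have "\<dots> \<le> b * (real d / real 1)" using mult_mono[of 1 b 1 "real d"] b1 d1 by simp
      finally show ?thesis unfolding \<eta>_def L_def by (simp add: min_def)
    qed
    have \<eta>_Suc: "\<eta> (Suc t) \<le> \<eta> t" if "t \<ge> 1" for t
    proof -
      have "b * (real d / real (Suc t)) \<le> b * (real d / real t)"
        using that b1 by (intro mult_left_mono divide_left_mono) auto
      thus ?thesis unfolding \<eta>_def by (intro min.mono order_refl)
    qed
    have slow: "real t / (real t + 1) * \<eta> t \<le> \<eta> (Suc t) \<and> 1 / (real t + 1) \<le> \<eta> t * (\<sigma> t)\<^sup>2 * \<gamma>1\<^sup>2 / (4 * real d)"
      if t: "t \<ge> 1" and less: "\<eta> (Suc t) < \<eta> t" for t
    proof -
      have u: "real t / (real t + 1) * (b * (real d / real t)) \<le> b * (real d / real (Suc t))"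
        using t by (simp add: add.commute)
      note * = min_schedule_slow[OF t \<eta>_def u _ less]
      have "b * (real d / real (Suc t)) \<le> \<eta> t"
        using *(1) less b1 by simp
      hence "b * (real d / real (Suc t)) * (s0 * \<gamma>1\<^sup>2) \<le> \<eta> t * (s0 * \<gamma>1\<^sup>2)"
        using s0 by (intro mult_right_mono) auto
      moreover have "4 * (real d / real (Suc t)) \<le> b * (s0 * \<gamma>1\<^sup>2) * (real d / real (Suc t))"
        using b_mult(3) by (intro mult_right_mono) auto
      ultimately have "4 * (real d / real (Suc t)) \<le> \<eta> t * (s0 * \<gamma>1\<^sup>2)"
        by (simp add: algebra_simps)
      hence "4 * (real d / real (Suc t)) / (4 * real d) \<le> \<eta> t * (s0 * \<gamma>1\<^sup>2) / (4 * real d)"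
        by (intro divide_right_mono) auto
      hence "1 / (real t + 1) \<le> \<eta> t * (\<sigma> t)\<^sup>2 * \<gamma>1\<^sup>2 / (4 * real d)"
        using d1 by (simp add: \<sigma>2 mult.assoc add.commute)
      thus ?thesis using *(2) b1 by simp
    qed
    have "\<forall>t\<ge>1. 0 < \<eta> t" "\<forall>t\<ge>1. \<eta> (Suc t) \<le> \<eta> t" "\<forall>t\<ge>1. \<eta> (Suc t) < \<eta> t \<longrightarrow>
        real t / (real t + 1) * \<eta> t \<le> \<eta> (Suc t) \<and>
        1 / (real t + 1) \<le> \<eta> t * (\<sigma> t)\<^sup>2 * \<gamma>1\<^sup>2 / (4 * real d)"
      "\<forall>t\<ge>1. 0 < \<sigma> t \<and> (\<sigma> t)\<^sup>2 \<le> s0"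
      using \<eta>_pos \<eta>_Suc slow s0 by (auto simp: \<sigma>_def)
    note bound = sgd_gap_bound[OF sgd init link d \<delta> \<eta>1 this T1]
    note [measurable] = bound(2)[OF T1]
    have "1 - ip d \<theta>star (\<theta> T \<omega>) \<le> \<epsilon>" if "1 - ip d \<theta>star (\<theta> T \<omega>) \<le> D * log_term \<delta> * real d * \<eta> T" for \<omega>
    proof -
      have "D * log_term \<delta> * real d * \<eta> T \<le> D * L * real d * (b * (real d / real T))"
        unfolding L_def[symmetric] using D_pos L1 by (intro mult_left_mono) (auto simp: \<eta>_def)
      also have "\<dots> = b * D * L * (real d)\<^sup>2 / real T" by (simp add: power2_eq_square)
      also have "\<dots> \<le> \<epsilon>"
        using T_ge T1 \<epsilon> by (simp add: divide_le_eq mult.commute)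
      finally show ?thesis using that by linarith
    qed
    hence "{\<omega> \<in> space M. \<forall>s\<in>{1..T}. 1 - ip d \<theta>star (\<theta> s \<omega>) \<le> D * log_term \<delta> * real d * \<eta> s
        \<and> 1 - ip d \<theta>star (\<theta> s \<omega>) \<le> \<gamma>0 / 2} \<subseteq> {\<omega> \<in> space M. ip d \<theta>star (\<theta> T \<omega>) \<ge> 1 - \<epsilon>}"
      using T1 by force
    moreover have "{\<omega> \<in> space M. ip d \<theta>star (\<theta> T \<omega>) \<ge> 1 - \<epsilon>} \<in> sets M"
    proof -
      have "{\<omega> \<in> space M. 1 - ip d \<theta>star (\<theta> T \<omega>) \<le> \<epsilon>} \<in> sets M" by measurable
      thus ?thesis by (simp add: algebra_simps)
    qed
    ultimately show ?thesis
      using order_trans[OF bound(1) finite_measure_mono] by blast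
  qed
  moreover have "schedules \<eta> \<sigma>"
    using \<eta>_pos s0 by (auto simp: schedules_def \<sigma>_def less_imp_le)
  moreover have "within_factor C ((\<sigma> t)\<^sup>2) 1" for t
  proof -
    have "1 / C \<le> s0" using C(3) s0 C(4) by (simp add: field_simps)
    thus ?thesis unfolding within_factor_def \<sigma>2 using s0 C(4) by simp
  qed
  ultimately show ?thesis
    using factor T1 T_le by blast
qed

lemma regret_minimization:
  fixes d :: nat and \<delta> :: real
  assumes d: "d \<ge> 2" and \<delta>: "\<delta> > 0" and link: "link_function \<gamma>0 \<gamma>1 \<gamma>2 f f'"
  defines "C \<equiv> 2 * \<gamma>2 * D + b + 1 / s0"
  shows "\<exists>\<eta> \<sigma>. schedules \<eta> \<sigma> \<and>
    (\<forall>t\<ge>1. within_factor (C * logs [real d, 1 / \<delta>, real t] ^ 1)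
              (\<eta> t) (min (1 / sqrt (real t)) (1 / real d)) \<and>
           within_factor (C * logs [real d, 1 / \<delta>, real t] ^ 1)
              ((\<sigma> t)\<^sup>2) (min (real d / sqrt (real t)) 1)) \<and>
    (\<forall>T\<ge>1.
       \<forall>(M::'w measure) \<theta>star \<theta> Z \<xi> a r.
          interactive_sgd M d f f' \<eta> \<sigma> \<theta>star \<theta> Z \<xi> a r \<and>
          (\<forall>\<omega>\<in>space M. ip d (\<theta> 1 \<omega>) \<theta>star \<ge> 1 - \<gamma>0 / 4) \<longrightarrow>
          measure M {\<omega> \<in> space M.
              (\<Sum>t=1..T. f 1 - f (ip d \<theta>star (\<theta> t \<omega>)))
                \<le> C * logs [real d, 1 / \<delta>, real T] ^ 1 * (real d * sqrt (real T))}
            \<ge> 1 - \<delta> * real T)"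
proof -
  define L where "L = log_term \<delta>"
  define \<eta> where "\<eta> t = min (1 * (1 / sqrt (real t))) (1 / real d / (b * L))" for t :: nat
  \<comment> \<open>The factor \<open>b * L * d\<close> makes \<sigma>^2 equal \<open>s0\<close>
    while \<eta> is at its cap. As \<sigma>^2 is proportional to \<eta> d, half the contraction rate
    becomes b L s0 \<gamma>1^2 \<eta>^2 / 4 \<ge> \<eta>^2, which is at least 1 / (t + 1) whenever
    \<eta> \<ge> 1 / sqrt (t + 1).\<close>
  define \<sigma> where "\<sigma> t = sqrt (s0 * (b * L) * real d * \<eta> t)" for t :: nat
  have L1: "1 \<le> L" unfolding L_def by (rule log_term_ge_1[OF \<delta>])
  have b1: "1 \<le> b" by (rule b_ge)
  have bL: "b \<le> b * L" using mult_left_mono[OF L1, of b] b1 by simp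
  have d1: "1 \<le> real d" using d by simp
  have C: "b \<le> C" "2 * \<gamma>2 * D \<le> C" "1 / s0 \<le> C" "1 \<le> C"
  proof -
    have "0 < 2 * \<gamma>2 * D" "0 < 1 / s0" using \<gamma>2 D_pos s0 by simp_all
    thus "b \<le> C" "2 * \<gamma>2 * D \<le> C" "1 / s0 \<le> C" "1 \<le> C" using b1 unfolding C_def by linarith+
  qed
  have \<eta>_pos: "0 < \<eta> t" if "t \<ge> 1" for t
    using that d1 b1 L1 by (simp add: \<eta>_def)
  have \<sigma>2: "(\<sigma> t)\<^sup>2 = s0 * (b * L) * real d * \<eta> t" if "t \<ge> 1" for t
    unfolding \<sigma>_def using s0 b1 L1 d1 \<eta>_pos[OF that] by (intro real_sqrt_pow2) auto
  have \<sigma>2': "(\<sigma> t)\<^sup>2 = s0 * min (b * L * (real d / sqrt (real t))) 1" if "t \<ge> 1" for t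
  proof -
    have "b * L * real d * \<eta> t = min (b * L * real d * (1 * (1 / sqrt (real t)))) (b * L * real d * (1 / real d / (b * L)))"
      unfolding \<eta>_def using b1 L1 d1 by (intro min_mult_distrib_left[THEN trans]) auto
    also have "\<dots> = min (b * L * (real d / sqrt (real t))) 1" using b1 L1 d1 by simp
    finally show ?thesis unfolding \<sigma>2[OF that] by (simp add: mult.assoc)
  qed
  have \<sigma>_ok: "0 < \<sigma> t \<and> (\<sigma> t)\<^sup>2 \<le> s0" if "t \<ge> 1" for t
  proof
    show "0 < \<sigma> t" unfolding \<sigma>_def using s0 b1 L1 d1 \<eta>_pos[OF that] by simp
    show "(\<sigma> t)\<^sup>2 \<le> s0" unfolding \<sigma>2'[OF that] using s0 by (simp add: mult_left_le)
  qed
  have logs: "L \<le> logs [real d, 1 / \<delta>, real t]" for t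
    using d1 \<delta> by (simp add: L_def logs_def log_term_def add_nonneg_nonneg)
  have CL: "b * L \<le> C * logs [real d, 1 / \<delta>, real t]" "1 / s0 \<le> C * logs [real d, 1 / \<delta>, real t]" for t
  proof -
    show "b * L \<le> C * logs [real d, 1 / \<delta>, real t]"
      using C(1,4) b1 L1 logs[of t] by (intro mult_mono) auto
    have "1 / s0 * 1 \<le> C * logs [real d, 1 / \<delta>, real t]"
      using C(3,4) s0 L1 logs[of t] by (intro mult_mono) auto
    thus "1 / s0 \<le> C * logs [real d, 1 / \<delta>, real t]" by simp
  qed
  have factor1: "within_factor (C * logs [real d, 1 / \<delta>, real t] ^ 1) (\<eta> t) (min (1 / sqrt (real t)) (1 / real d))" for t
    unfolding \<eta>_def power_one_right using b1 bL CL[of t] by (intro within_factor_min) (linarith | simp)+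
  have factor2: "within_factor (C * logs [real d, 1 / \<delta>, real t] ^ 1) ((\<sigma> t)\<^sup>2) (min (real d / sqrt (real t)) 1)"
    if "t \<ge> 1" for t
  proof -
    define K where "K = C * logs [real d, 1 / \<delta>, real t]"
    let ?x = "real d / sqrt (real t)"
    have K: "b * L \<le> K" "1 / s0 \<le> K" "1 \<le> K" using CL[of t] b1 bL unfolding K_def by linarith+
    have x0: "0 \<le> ?x" by simp
    have "within_factor K (min (b * L * ?x) (1 / 1)) (min ?x 1)"
      using K b1 bL x0 by (intro within_factor_min) (linarith | simp)+
    hence 1: "min (b * L * ?x) 1 \<le> K * min ?x 1" by (simp add: within_factor_def)
    have "s0 * min (b * L * ?x) 1 \<le> min (b * L * ?x) 1"
      using s0 b1 L1 x0 by (intro mult_left_le_one_le) auto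
    hence u: "s0 * min (b * L * ?x) 1 \<le> K * min ?x 1" using 1 by linarith
    have "1 / K \<le> s0" using K s0 by (simp add: field_simps)
    hence "min ?x 1 * (1 / K) \<le> min ?x 1 * s0" using x0 by (intro mult_left_mono) auto
    also have "\<dots> = s0 * min ?x 1" by (rule mult.commute)
    also have "\<dots> \<le> s0 * min (b * L * ?x) 1"
      using s0 mult_right_mono[of 1 "b * L" ?x] x0 b1 bL by (intro mult_left_mono min.mono) auto
    finally have "min ?x 1 / K \<le> s0 * min (b * L * ?x) 1" by simp
    thus ?thesis
      using u unfolding within_factor_def \<sigma>2'[OF that] power_one_right K_def[symmetric] by blast
  qed
  have "measure M {\<omega> \<in> space M. (\<Sum>t=1..T. f 1 - f (ip d \<theta>star (\<theta> t \<omega>)))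
      \<le> C * logs [real d, 1 / \<delta>, real T] ^ 1 * (real d * sqrt (real T))} \<ge> 1 - \<delta> * real T"
    if T1: "T \<ge> 1" and sgd: "interactive_sgd M d f f' \<eta> \<sigma> \<theta>star \<theta> Z \<xi> a r"
      and init: "\<forall>\<omega>\<in>space M. ip d (\<theta> 1 \<omega>) \<theta>star \<ge> 1 - \<gamma>0 / 4"
    for T and M :: "'w measure" and \<theta>star \<theta> Z \<xi> a r
  proof -
    interpret interactive_sgd M d f f' \<eta> \<sigma> \<theta>star \<theta> Z \<xi> a r by (rule sgd)
    have \<eta>1: "\<eta> 1 = 1 / real d / (b * log_term \<delta>)"
    proof -
      have "1 / real d / (b * L) \<le> 1 / 1 / 1"
        using d1 b1 bL by (intro frac_le) (linarith | simp)+
      thus ?thesis unfolding \<eta>_def L_def by (simp add: min_def)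
    qed
    have \<eta>_Suc: "\<eta> (Suc t) \<le> \<eta> t" if "t \<ge> 1" for t
    proof -
      have "1 * (1 / sqrt (real (Suc t))) \<le> 1 * (1 / sqrt (real t))"
        using that by (intro mult_left_mono divide_left_mono) auto
      thus ?thesis unfolding \<eta>_def by (intro min.mono order_refl)
    qed
    have slow: "real t / (real t + 1) * \<eta> t \<le> \<eta> (Suc t) \<and> 1 / (real t + 1) \<le> \<eta> t * (\<sigma> t)\<^sup>2 * \<gamma>1\<^sup>2 / (4 * real d)"
      if t: "t \<ge> 1" and less: "\<eta> (Suc t) < \<eta> t" for t
    proof -
      have u: "real t / (real t + 1) * (1 * (1 / sqrt (real t))) \<le> 1 * (1 / sqrt (real (Suc t)))"
      proof -
        have "sqrt (real t) * sqrt (real (Suc t)) \<le> sqrt (real (Suc t)) * sqrt (real (Suc t))"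
          by (intro mult_right_mono) auto
        hence "sqrt (real t) * sqrt (real (Suc t)) \<le> real t + 1" by simp
        moreover have "real t / (real t + 1) * (1 / sqrt (real t)) = sqrt (real t) / (real t + 1)"
        proof -
          have "real t / (real t + 1) * (1 / sqrt (real t)) = (real t / sqrt (real t)) / (real t + 1)"
            by simp
          thus ?thesis by (simp only: real_div_sqrt of_nat_0_le_iff)
        qed
        ultimately show ?thesis using t by (simp add: divide_le_eq le_divide_eq mult.commute)
      qed
      note * = min_schedule_slow[OF t \<eta>_def u _ less]
      have ge: "1 / sqrt (real (Suc t)) \<le> \<eta> t"
        using *(1) less by simp
      have "1 / (real t + 1) = 1 / sqrt (real (Suc t)) * (1 / sqrt (real (Suc t)))" by simp
      also have "\<dots> \<le> \<eta> t * \<eta> t"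
        using ge \<eta>_pos[OF t] by (intro mult_mono) auto
      also have "\<dots> = \<eta> t * \<eta> t * 4 / 4" by simp
      also have "\<dots> \<le> \<eta> t * \<eta> t * (b * L * (s0 * \<gamma>1\<^sup>2)) / 4"
        using b_mult(3) mult_right_mono[OF bL, of "s0 * \<gamma>1\<^sup>2"] s0
        by (intro divide_right_mono mult_left_mono) auto
      also have "\<dots> = \<eta> t * (\<sigma> t)\<^sup>2 * \<gamma>1\<^sup>2 / (4 * real d)"
        unfolding \<sigma>2[OF t] using d1 by (simp add: field_simps)
      finally show ?thesis using *(2) by simp
    qed
    have "\<forall>t\<ge>1. 0 < \<eta> t" "\<forall>t\<ge>1. \<eta> (Suc t) \<le> \<eta> t" "\<forall>t\<ge>1. \<eta> (Suc t) < \<eta> t \<longrightarrow>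
        real t / (real t + 1) * \<eta> t \<le> \<eta> (Suc t) \<and>
        1 / (real t + 1) \<le> \<eta> t * (\<sigma> t)\<^sup>2 * \<gamma>1\<^sup>2 / (4 * real d)"
      "\<forall>t\<ge>1. 0 < \<sigma> t \<and> (\<sigma> t)\<^sup>2 \<le> s0"
      using \<eta>_pos \<eta>_Suc slow \<sigma>_ok by blast+
    note bound = sgd_gap_bound[OF sgd init link d \<delta> \<eta>1 this T1]
    let ?S = "\<lambda>\<omega>. \<Sum>t=1..T. f 1 - f (ip d \<theta>star (\<theta> t \<omega>))"
    have "?S \<omega> \<le> C * logs [real d, 1 / \<delta>, real T] * (real d * sqrt (real T))"
      if g: "\<And>s. s \<in> {1..T} \<Longrightarrow> 1 - ip d \<theta>star (\<theta> s \<omega>) \<le> D * log_term \<delta> * real d * \<eta> s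
        \<and> 1 - ip d \<theta>star (\<theta> s \<omega>) \<le> \<gamma>0 / 2" and \<omega>: "\<omega> \<in> space M" for \<omega>
    proof -
      have "?S \<omega> \<le> (\<Sum>t=1..T. \<gamma>2 * (D * L * real d * (1 / sqrt (real t))))"
      proof (rule sum_mono)
        fix s assume s: "s \<in> {1..T}"
        \<comment> \<open>The second conjunct of the gap bound is used here: it places the argument
          in the region where the slope is at most \<gamma>2.\<close>
        have "f 1 - f (ip d \<theta>star (\<theta> s \<omega>)) \<le> \<gamma>2 * (1 - ip d \<theta>star (\<theta> s \<omega>))"
          using g[OF s] bound(3)[of s \<omega>] s \<omega> \<gamma>0 by (intro link_slope(2)[OF link]) auto
        also have "\<dots> \<le> \<gamma>2 * (D * L * real d * (1 / sqrt (real s)))"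
        proof -
          have "D * L * real d * \<eta> s \<le> D * L * real d * (1 / sqrt (real s))"
            using D_pos L1 by (intro mult_left_mono) (auto simp: \<eta>_def)
          thus ?thesis using g[OF s] \<gamma>2 unfolding L_def[symmetric] by (intro mult_left_mono) auto
        qed
        finally show "f 1 - f (ip d \<theta>star (\<theta> s \<omega>)) \<le> \<gamma>2 * (D * L * real d * (1 / sqrt (real s)))" .
      qed
      also have "\<dots> = \<gamma>2 * (D * L * real d) * (\<Sum>t=1..T. 1 / sqrt (real t))"
        by (simp add: sum_distrib_left mult.assoc)
      also have "\<dots> \<le> \<gamma>2 * (D * L * real d) * (2 * sqrt (real T))"
        using \<gamma>2 D_pos L1 by (intro mult_left_mono sum_inverse_sqrt_le) auto
      also have "\<dots> = 2 * \<gamma>2 * D * L * (real d * sqrt (real T))" by (simp add: algebra_simps)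
      also have "\<dots> \<le> C * logs [real d, 1 / \<delta>, real T] * (real d * sqrt (real T))"
        using C \<gamma>2 D_pos L1 logs[of T] by (intro mult_right_mono mult_mono) auto
      finally show ?thesis .
    qed
    hence "{\<omega> \<in> space M. \<forall>s\<in>{1..T}. 1 - ip d \<theta>star (\<theta> s \<omega>) \<le> D * log_term \<delta> * real d * \<eta> s
        \<and> 1 - ip d \<theta>star (\<theta> s \<omega>) \<le> \<gamma>0 / 2}
      \<subseteq> {\<omega> \<in> space M. ?S \<omega> \<le> C * logs [real d, 1 / \<delta>, real T] * (real d * sqrt (real T))}"
      by blast
    moreover have "{\<omega> \<in> space M. ?S \<omega> \<le> C * logs [real d, 1 / \<delta>, real T] * (real d * sqrt (real T))} \<in> sets M"
    proof -
      have "(\<lambda>\<omega>. f (ip d \<theta>star (\<theta> s \<omega>))) \<in> borel_measurable M" if s: "s \<in> {1..T}" for s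
      proof (rule link_measurable[OF link])
        have "(\<lambda>\<omega>. 1 - (1 - ip d \<theta>star (\<theta> s \<omega>))) \<in> borel_measurable M"
          by (rule borel_measurable_diff[OF borel_measurable_const bound(2)]) (use s in simp)
        thus "(\<lambda>\<omega>. ip d \<theta>star (\<theta> s \<omega>)) \<in> borel_measurable M" by simp
        show "ip d \<theta>star (\<theta> s \<omega>) \<in> {-1..1}" if "\<omega> \<in> space M" for \<omega>
          using bound(3)[of s \<omega>] s that by auto
      qed
      hence [measurable]: "?S \<in> borel_measurable M" by (intro borel_measurable_sum borel_measurable_diff) auto
      show ?thesis by measurable
    qed
    ultimately show ?thesis
      unfolding power_one_right by (intro order_trans[OF bound(1)] finite_measure_mono)
  qed
  moreover have "schedules \<eta> \<sigma>"
  proof -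
    have "\<sigma> t \<le> 1" "0 \<le> \<sigma> t" if "t \<ge> 1" for t
      using \<sigma>_ok[OF that] s0 power_le_one_iff[of "\<sigma> t" 2] by auto
    thus ?thesis using \<eta>_pos by (auto simp: schedules_def)
  qed
  ultimately show ?thesis
    using factor1 factor2 by blast
qed

end

theorem theorem1p3:
  fixes \<gamma>0 \<gamma>1 \<gamma>2 :: real
  assumes "0 < \<gamma>0" and "\<gamma>0 \<le> 1 / 10" and "0 < \<gamma>1" and "0 < \<gamma>2"
  shows
    "(\<exists>(C::real) (k::nat). C > 0 \<and>
       (\<forall>(d::nat) (\<epsilon>::real) (\<delta>::real) f f'.
          d \<ge> 2 \<and> \<epsilon> > 0 \<and> \<delta> > 0 \<and> link_function \<gamma>0 \<gamma>1 \<gamma>2 f f' \<longrightarrow>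
          (\<exists>\<eta> \<sigma>. schedules \<eta> \<sigma> \<and>
             (\<forall>t\<ge>1. within_factor (C * logs [real d, 1 / \<epsilon>, 1 / \<delta>, real t] ^ k)
                       (\<eta> t) (min (real d / real t) (1 / real d)) \<and>
                    within_factor C ((\<sigma> t)\<^sup>2) 1) \<and>
             (\<exists>T\<ge>1. int T \<le> \<lceil>C * logs [real d, 1 / \<epsilon>, 1 / \<delta>] ^ k * ((real d)\<^sup>2 / \<epsilon>)\<rceil> \<and>
                (\<forall>(M::'w measure) \<theta>star \<theta> Z \<xi> a r.
                   interactive_sgd M d f f' \<eta> \<sigma> \<theta>star \<theta> Z \<xi> a r \<and>
                   (\<forall>\<omega>\<in>space M. ip d (\<theta> 1 \<omega>) \<theta>star \<ge> 1 - \<gamma>0 / 4) \<longrightarrow>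
                   measure M {\<omega> \<in> space M. ip d \<theta>star (\<theta> T \<omega>) \<ge> 1 - \<epsilon>} \<ge> 1 - \<delta> * real T)))))
     \<and>
     (\<exists>(C::real) (k::nat). C > 0 \<and>
       (\<forall>(d::nat) (\<delta>::real) f f'.
          d \<ge> 2 \<and> \<delta> > 0 \<and> link_function \<gamma>0 \<gamma>1 \<gamma>2 f f' \<longrightarrow>
          (\<exists>\<eta> \<sigma>. schedules \<eta> \<sigma> \<and>
             (\<forall>t\<ge>1. within_factor (C * logs [real d, 1 / \<delta>, real t] ^ k)
                       (\<eta> t) (min (1 / sqrt (real t)) (1 / real d)) \<and>
                    within_factor (C * logs [real d, 1 / \<delta>, real t] ^ k)
                       ((\<sigma> t)\<^sup>2) (min (real d / sqrt (real t)) 1)) \<and>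
             (\<forall>T\<ge>1.
                \<forall>(M::'w measure) \<theta>star \<theta> Z \<xi> a r.
                   interactive_sgd M d f f' \<eta> \<sigma> \<theta>star \<theta> Z \<xi> a r \<and>
                   (\<forall>\<omega>\<in>space M. ip d (\<theta> 1 \<omega>) \<theta>star \<ge> 1 - \<gamma>0 / 4) \<longrightarrow>
                   measure M {\<omega> \<in> space M.
                       (\<Sum>t=1..T. f 1 - f (ip d \<theta>star (\<theta> t \<omega>)))
                         \<le> C * logs [real d, 1 / \<delta>, real T] ^ k * (real d * sqrt (real T))}
                     \<ge> 1 - \<delta> * real T))))"
proof -
  interpret link_constants \<gamma>0 \<gamma>1 \<gamma>2 using assms by unfold_locales
  have pos: "0 < b * D + b + 1 / s0" "0 < 2 * \<gamma>2 * D + b + 1 / s0"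
    using b_ge(1) D_pos s0 \<gamma>2 by (simp_all add: add_pos_pos)
  show ?thesis
    \<comment> \<open>The exponent of \<open>logs\<close> is 1 in both parts: a single factor
      \<open>log_term \<delta>\<close> enters every bound.\<close>
    by (rule conjI; rule exI, rule exI[of _ 1], rule conjI, rule pos, intro allI impI, elim conjE)
       (rule pure_exploration regret_minimization; assumption)+
qed

end
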